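(* Let $0<p_0\le 1$, let $\Lambda,\Pi\subseteq\mathbb{R}^d$ be relatively separated, and let $A\in\mathcal{C}^{p_0}(\Lambda,\Pi)$. Assume that there exist $p\in[p_0,\infty]$ and $C_0>0$ such that $\|Ac\|_p\ge C_0\|c\|_p$ for all $c\in\ell^p(\Pi)$. Then there exists a constant $C>0$, independent of $q$, such that for every $q\in[p_0,\infty]$, $\|Ac\|_q\ge C\|c\|_q$ for all $c\in\ell^q(\Pi)$.
   Context: $B_1(x)$ is the ball of radius $1$ centred at $x$. A set $\Lambda\subseteq\mathbb{R}^d$ is relatively separated if $\operatorname{rel}(\Lambda)=\sup_{x\in\mathbb{R}^d}\#(\Lambda\cap B_1(x))<\infty$. For $0<p\le\infty$, $\|c\|_p=(\sum_{\rho}|c_\rho|^p)^{1/p}$ (supremum for $p=\infty$) is the quasi-norm of $\ell^p$ over the relevant index set. $C_b(\mathbb{R}^d)$ is the space of bounded continuous functions, and $W(C_b,L^{p_0})$ is the Wiener amalgam space of all $f\in C_b(\mathbb{R}^d)$ with $\left(\int_{\mathbb{R}^d}\|f\|_{L^\infty(B_1(x))}^{p_0}\,dx\right)^{1/p_0}<\infty$. $\mathcal{C}^{p_0}(\Lambda,\Pi)$ is the set of all complex matrices $A=(a_{\lambda,\rho})_{\lambda\in\Lambda,\rho\in\Pi}$ for which there is an envelope $H\in W(C_b,L^{p_0})$ with $|a_{\lambda,\rho}|\le H(\lambda-\rho)$ for all $\lambda\in\Lambda$, $\rho\in\Pi$. A matrix acts by $(Ac)_\lambda=\sum_{\rho\in\Pi}a_{\lambda,\rho}c_\rho$;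 each $A\in\mathcal{C}^{p_0}(\Lambda,\Pi)$ is bounded from $\ell^q(\Pi)$ to $\ell^q(\Lambda)$ for all $q\in[p_0,\infty]$. *)

theory Defs
  imports "HOL-Analysis.Analysis" "HOL-Probability.Essential_Supremum"
begin

text \<open>The power \<open>x\<^sup>a\<close> on \<open>[0,\<infinity>]\<close>, meant for exponents \<open>a > 0\<close>.\<close>

definition ennpowr :: "ennreal \<Rightarrow> real \<Rightarrow> ennreal" where
  "ennpowr x a = (if x = \<infinity> then \<infinity> else ennreal (enn2real x powr a))"

text \<open>Relative separation; \<open>#\<close> is counting measure, so an infinite set has cardinality \<open>\<infinity>\<close>.\<close>

definition rel :: "(real ^ 'd) set \<Rightarrow> ennreal" where
  "rel \<Lambda> = (SUP x. emeasure (count_space UNIV) (\<Lambda> \<inter> ball x 1))"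

definition relatively_separated :: "(real ^ 'd) set \<Rightarrow> bool" where
  "relatively_separated \<Lambda> \<longleftrightarrow> rel \<Lambda> < \<infinity>"

text \<open>Sequences over \<open>I\<close> are total functions whose values outside \<open>I\<close> are never consulted.
  The quasi-norm takes values in \<open>[0,\<infinity>]\<close>, and \<open>\<ell>\<^sup>p(I)\<close> is the set where it is finite.\<close>

definition lp_norm :: "ennreal \<Rightarrow> 'i set \<Rightarrow> ('i \<Rightarrow> complex) \<Rightarrow> ennreal" where
  "lp_norm p I c =
    (if p = \<infinity> then (SUP i\<in>I. ennreal (cmod (c i)))
     else ennpowr (\<Sum>\<^sub>\<infinity>i\<in>I. ennreal (cmod (c i) powr enn2real p)) (1 / enn2real p))"

definition lp :: "ennreal \<Rightarrow> 'i set \<Rightarrow> ('i \<Rightarrow> complex) set" where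
  "lp p I = {c. lp_norm p I c < \<infinity>}"

definition Linf_norm_on :: "(real ^ 'd) set \<Rightarrow> (real ^ 'd \<Rightarrow> 'b::real_normed_vector) \<Rightarrow> ennreal" where
  "Linf_norm_on S f = esssup (restrict_space lborel S) (\<lambda>y. ennreal (norm (f y)))"

text \<open>The Wiener amalgam space \<open>W(C\<^sub>b, L\<^sup>p)\<close>, for \<open>0 < p < \<infinity>\<close>.\<close>

definition amalgam_norm :: "real \<Rightarrow> (real ^ 'd \<Rightarrow> 'b::real_normed_vector) \<Rightarrow> ennreal" where
  "amalgam_norm p f =
    ennpowr (\<integral>\<^sup>+ x. ennpowr (Linf_norm_on (ball x 1) f) p \<partial>lborel) (1 / p)"

definition wiener_amalgam :: "real \<Rightarrow> (real ^ 'd \<Rightarrow> 'b::real_normed_vector) set" where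
  "wiener_amalgam p = {f \<in> bcontfun. amalgam_norm p f < \<infinity>}"

text \<open>Matrices indexed by \<open>\<Lambda> \<times> \<Gamma>\<close> are likewise total functions, used only on \<open>\<Lambda> \<times> \<Gamma>\<close>.
  Envelopes are taken real-valued.\<close>

definition conv_dominated :: "real \<Rightarrow> (real ^ 'd) set \<Rightarrow> (real ^ 'd) set
    \<Rightarrow> (real ^ 'd \<Rightarrow> real ^ 'd \<Rightarrow> complex) set" where
  "conv_dominated p \<Lambda> \<Gamma> =
    {A. \<exists>H :: real ^ 'd \<Rightarrow> real. H \<in> wiener_amalgam p \<and>
          (\<forall>x\<in>\<Lambda>. \<forall>y\<in>\<Gamma>. cmod (A x y) \<le> H (x - y))}"

definition mat_apply :: "('j \<Rightarrow> 'i \<Rightarrow> complex) \<Rightarrow> 'i set \<Rightarrow> ('i \<Rightarrow> complex) \<Rightarrow> 'j \<Rightarrow> complex" where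
  "mat_apply A I c = (\<lambda>j. \<Sum>\<^sub>\<infinity>i\<in>I. A j i * c i)"

end

theory Submission
  imports Defs
begin

text \<open>The idea is Sjoestrand's: a lower bound at one exponent is applied to pieces of \<open>c\<close> of a fixed
  large diameter \<open>T\<close>, where all \<open>\<ell>\<^sup>q\<close> quasi-norms are comparable, and the pieces are reassembled at the
  exponent \<open>q\<close>. What has to be paid is the commutator of the matrix with the cutoff functions, and this
  is small when \<open>T\<close> is large.

  Write \<open>s = p\<^sub>0\<close> and pass to \<open>u = |c|\<^sup>s\<close> on \<open>\<Gamma>\<close> and \<open>v = |A c|\<^sup>s\<close> on \<open>\<Lambda>\<close>. The \<open>s\<close>-th power of
  the \<open>\<ell>\<^sup>p\<close> quasi-norm of \<open>c\<close> is the \<open>\<ell>\<^sup>r\<close> norm of \<open>u\<close> with \<open>r = p/s \<ge> 1\<close>. Since \<open>s \<le> 1\<close>, a matrix acts on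
  such powers subadditively, through the \<open>s\<close>-th powers of its entries, which are dominated by
  \<open>|H|\<^sup>s\<close>. The suprema of \<open>|H|\<^sup>s\<close> over small lattice cells are summable
  (\<open>nsum_cell_sup_finite\<close>), so Schur's test applies to every kernel built from them, with a
  bound that is the same for all exponents.

  Let \<open>\<psi>\<^sub>k\<close> be a bump of slope \<open>1/T\<close> equal to \<open>1\<close> on the cell \<open>k\<close> of side \<open>T\<close>, and let \<open>U k\<close> be the
  \<open>\<ell>\<^bsup>p/s\<^esup>\<close> norm of \<open>u\<close> on this cell. The hypothesis for \<open>\<psi>\<^sub>k c\<close> and the identity
  \<open>A \<psi>\<^sub>k = \<psi>\<^sub>k A + [A, \<psi>\<^sub>k]\<close> give (\<open>local_lower_bound\<close>)

    \<open>C\<^sub>0\<^sup>s U k \<le> 2 (\<Sum> of v near cell k) + 2 (\<Sum>j. V k j * U j)\<close>,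

  where \<open>V k j\<close> bounds the commutator between the cells \<open>j\<close> and \<open>k\<close>. An entry of the commutator with
  index difference \<open>x\<close> carries the factor \<open>min 1 (|x|/T)\<^sup>s\<close>, and every such \<open>x\<close> contributes, for
  fixed \<open>k\<close> or fixed \<open>j\<close>, to a number of cells that is bounded independently of \<open>T\<close>. Hence the row and column sums of \<open>V\<close> are at most a constant
  times \<open>\<Sum>m. min 1 (|m|/T)\<^sup>s g m\<close> with \<open>g\<close> summable (\<open>block_weight_sums\<close>), which tends to \<open>0\<close>
  as \<open>T\<close> grows (\<open>damped_sum_small\<close>).

  Now fix \<open>T\<close> such that the norm of \<open>V\<close> is small compared with \<open>C\<^sub>0\<^sup>s\<close>, take \<open>\<ell>\<^bsup>q/s\<^esup>\<close> norms over \<open>k\<close>, and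
  absorb the last term. Schur's test also compares \<open>u\<close> with \<open>U\<close> and the sums of \<open>v\<close> near the cells
  with \<open>v\<close>, again with constants that do not involve \<open>q\<close>.\<close>

section \<open>Powers on the extended half-line\<close>

lemma ennpowr_ennreal: "0 \<le> x \<Longrightarrow> ennpowr (ennreal x) a = ennreal (x powr a)"
  by (simp add: ennpowr_def)

lemma ennpowr_top [simp]: "ennpowr top a = top"
  by (simp add: ennpowr_def)

lemma ennpowr_0 [simp]: "ennpowr 0 a = 0"
  by (simp add: ennpowr_def)

lemma ennpowr_1 [simp]: "ennpowr x 1 = x"
  by (cases x) (simp_all add: ennpowr_ennreal)

lemma ennpowr_one [simp]: "ennpowr 1 a = 1"
  using ennpowr_ennreal[of 1 a] by simp

lemma ennpowr_mono: "x \<le> y \<Longrightarrow> 0 \<le> a \<Longrightarrow> ennpowr x a \<le> ennpowr y a"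
  by (cases x; cases y) (auto simp: ennpowr_ennreal powr_mono2 top_unique)

lemma ennpowr_ennpowr: "ennpowr (ennpowr x a) b = ennpowr x (a * b)"
  by (cases x) (auto simp: ennpowr_ennreal powr_powr)

lemma ennpowr_mult: "0 < a \<Longrightarrow> ennpowr (x * y) a = ennpowr x a * ennpowr y a"
  by (cases x; cases y)
    (auto simp: ennpowr_ennreal powr_mult ennreal_mult[symmetric] ennreal_mult_eq_top_iff
      ennreal_top_mult ennreal_mult_top split: if_splits)

lemma ennpowr_eq_0_iff [simp]: "ennpowr x a = 0 \<longleftrightarrow> x = 0"
  by (cases x) (auto simp: ennpowr_ennreal)

lemma ennpowr_eq_top_iff [simp]: "ennpowr x a = top \<longleftrightarrow> x = top"
  by (cases x) (auto simp: ennpowr_ennreal)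

lemma ennpowr_less_top_iff [simp]: "ennpowr x a < top \<longleftrightarrow> x < top"
  by (simp flip: top.not_eq_extremum)

lemma ennpowr_le_iff: "0 < a \<Longrightarrow> ennpowr x a \<le> ennpowr y a \<longleftrightarrow> x \<le> y"
  using ennpowr_mono[of "ennpowr x a" "ennpowr y a" "1/a"] ennpowr_mono[of x y a]
  by (auto simp: ennpowr_ennpowr)

lemma ennpowr_inverse_le_iff: "0 < a \<Longrightarrow> ennpowr x (1/a) \<le> y \<longleftrightarrow> x \<le> ennpowr y a"
  using ennpowr_le_iff[of a "ennpowr x (1/a)" y] by (simp add: ennpowr_ennpowr)

lemma ennpowr_le_inverse_iff: "0 < a \<Longrightarrow> y \<le> ennpowr x (1/a) \<longleftrightarrow> ennpowr y a \<le> x"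
  using ennpowr_le_iff[of a y "ennpowr x (1/a)"] by (simp add: ennpowr_ennpowr)

lemma ennpowr_SUP:
  assumes "0 < a"
  shows "ennpowr (SUP i\<in>I. f i) a = (SUP i\<in>I. ennpowr (f i) a)"
proof (rule antisym)
  have "(SUP i\<in>I. f i) \<le> ennpowr (SUP i\<in>I. ennpowr (f i) a) (1/a)"
    using assms by (intro SUP_least) (auto simp: ennpowr_le_inverse_iff intro: SUP_upper)
  then show "ennpowr (SUP i\<in>I. f i) a \<le> (SUP i\<in>I. ennpowr (f i) a)"
    using assms by (simp add: ennpowr_le_inverse_iff)
  show "(SUP i\<in>I. ennpowr (f i) a) \<le> ennpowr (SUP i\<in>I. f i) a"
    using assms by (intro SUP_least ennpowr_mono SUP_upper) auto
qed

lemma ennpowr_split_factor: "1 \<le> r \<Longrightarrow> ennpowr x r = x * ennpowr x (r - 1)"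
proof (cases x)
  case (real u)
  assume "1 \<le> r"
  have "u powr r = u * u powr (r - 1)"
    using real by (cases "u = 0") (auto simp: powr_diff)
  then show ?thesis
    using real by (simp add: ennpowr_ennreal ennreal_mult[symmetric])
qed (simp add: ennreal_top_mult)

text \<open>A two-term estimate whose constant becomes \<open>2\<close> after taking the root of order \<open>a\<close>,
  for every \<open>a\<close>. It replaces Minkowski's inequality wherever a constant factor is harmless.\<close>

lemma ennpowr_add_le:
  assumes "0 < a"
  shows "ennpowr (x + y) a \<le> ennreal (2 powr a) * (ennpowr x a + ennpowr y a)"
proof -
  have "x + y \<le> ennreal 2 * max x y"
  proof -
    have "x + y \<le> max x y + max x y" by (intro add_mono) auto
    also have "\<dots> = ennreal 2 * max x y" by (simp add: mult_2[symmetric])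
    finally show ?thesis .
  qed
  then have "ennpowr (x + y) a \<le> ennpowr (ennreal 2 * max x y) a"
    using assms by (intro ennpowr_mono) auto
  also have "\<dots> = ennreal (2 powr a) * ennpowr (max x y) a"
    using assms by (simp add: ennpowr_mult ennpowr_ennreal del: ennreal_numeral)
  also have "\<dots> \<le> ennreal (2 powr a) * (ennpowr x a + ennpowr y a)"
    by (intro mult_left_mono) (auto simp: max_def)
  finally show ?thesis .
qed

section \<open>Unordered sums of extended nonnegative terms\<close>

text \<open>Sums over the whole index type, written as integrals for the counting measure: monotonicity
  and linearity are then those of the integral, and the order of summation can be exchanged without
  countability assumptions. Sums over a subset are obtained by multiplying with its indicator.\<close>

abbreviation nsum :: "('i \<Rightarrow> ennreal) \<Rightarrow> ennreal" where
  "nsum f \<equiv> \<integral>\<^sup>+ i. f i \<partial>count_space UNIV"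

lemma nsum_swap: "nsum (\<lambda>i. nsum (\<lambda>j. f i j)) = nsum (\<lambda>j. nsum (\<lambda>i. f i j))"
proof -
  have "nsum (\<lambda>i. nsum (\<lambda>j. f i j)) = nsum (case_prod f)"
    using nn_integral_fst_count_space[of "case_prod f"] by simp
  also have "\<dots> = nsum (\<lambda>j. nsum (\<lambda>i. f i j))"
    using nn_integral_snd_count_space[of "case_prod f"] by simp
  finally show ?thesis .
qed

lemma nsum_cmult: "nsum (\<lambda>i. a * f i) = a * nsum f"
  by (rule nn_integral_cmult) simp

lemma nsum_multc: "nsum (\<lambda>i. f i * a) = nsum f * a"
  by (rule nn_integral_multc) simp

lemma nsum_add: "nsum (\<lambda>i. f i + g i) = nsum f + nsum g"
  by (rule nn_integral_add) simp_all

lemma nsum_single: "nsum (\<lambda>i. f i * indicator {j} i) = f j"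
  by (subst nn_integral_count_space'[of "{j}"]) (auto split: split_indicator)

lemma le_nsum: "f i \<le> nsum f"
  using nn_integral_mono[of "count_space UNIV" "\<lambda>j. f j * indicator {i} j" f]
  by (simp add: nsum_single) (auto split: split_indicator)

lemma nsum_mono: "(\<And>i. f i \<le> g i) \<Longrightarrow> nsum f \<le> nsum g"
  by (rule nn_integral_mono) simp

lemma nsum_partition: "nsum f = nsum (\<lambda>j. nsum (\<lambda>i. f i * indicator {i. h i = j} i))"
proof -
  have "f i = nsum (\<lambda>j. f i * indicator {i. h i = j} i)" for i
  proof -
    have "nsum (\<lambda>j. f i * indicator {i. h i = j} i) = nsum (\<lambda>j. f i * indicator {h i} j)"
      by (intro nn_integral_cong) (auto split: split_indicator)
    then show ?thesis by (simp add: nsum_single[of "\<lambda>_. f i"])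
  qed
  then have "nsum f = nsum (\<lambda>i. nsum (\<lambda>j. f i * indicator {i. h i = j} i))"
    by presburger
  then show ?thesis by (simp add: nsum_swap[of "\<lambda>i j. f i * indicator {i. h i = j} i"])
qed

text \<open>The embedding of \<open>\<ell>\<^sup>1\<close> into \<open>\<ell>\<^sup>r\<close>: every term is at most the full sum \<open>\<sigma>\<close>, so
  \<open>f\<^sup>r = f * f\<^bsup>r-1\<^esup> \<le> f * \<sigma>\<^bsup>r-1\<^esup>\<close>.\<close>

lemma nsum_powr_le:
  assumes "1 \<le> r"
  shows "nsum (\<lambda>i. ennpowr (f i) r) \<le> ennpowr (nsum f) r"
proof -
  have "nsum (\<lambda>i. ennpowr (f i) r) \<le> nsum (\<lambda>i. f i * ennpowr (nsum f) (r - 1))"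
    using assms
    by (intro nsum_mono) (auto simp: ennpowr_split_factor intro!: mult_left_mono ennpowr_mono le_nsum)
  also have "\<dots> = ennpowr (nsum f) r"
    using assms by (simp add: nsum_multc ennpowr_split_factor)
  finally show ?thesis .
qed

text \<open>Here \<open>s \<le> 1\<close> enters. The inequality turns a complex sum, bounded through absolute values,
  into a sum of \<open>s\<close>-th powers. This is the previous lemma for the exponent \<open>1/s\<close>.\<close>

lemma powr_nsum_le:
  assumes "0 < s" "s \<le> 1"
  shows "ennpowr (nsum f) s \<le> nsum (\<lambda>i. ennpowr (f i) s)"
  using nsum_powr_le[of "1/s" "\<lambda>i. ennpowr (f i) s"] assms
  by (simp add: ennpowr_ennpowr ennpowr_le_inverse_iff)

text \<open>The tangent to the convex function \<open>z \<mapsto> z\<^sup>r\<close> at \<open>a\<close>, solved for \<open>z\<close>.\<close>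

lemma young_tangent:
  fixes z a :: real
  assumes "1 < r" "0 \<le> z" "0 < a"
  shows "z \<le> z powr r * a powr (1 - r) / r + (1 - 1/r) * a"
proof (cases "z = 0")
  case False
  have "(z powr r * a powr (1 - r)) powr (1/r) * a powr (1 - 1/r)
      \<le> 1/r * (z powr r * a powr (1 - r)) + (1 - 1/r) * a"
    using assms False by (intro Youngs_inequality_0) auto
  moreover have "(z powr r * a powr (1 - r)) powr (1/r) * a powr (1 - 1/r) = z"
  proof -
    have "(1 - r) / r + (1 - 1/r) = 0" using assms by (simp add: field_simps)
    then show ?thesis using assms False 
      by (simp add: powr_mult powr_powr mult.assoc flip: powr_add)
  qed
  ultimately show ?thesis by simp
qed (use assms in auto)

text \<open>Jensen's inequality for weights of total mass at most \<open>M\<close>. The convex function is replaced by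
  its tangent at a point \<open>a\<close>, which is summed against the weights; the best \<open>a\<close> is the
  \<open>r\<close>-th root of the average of \<open>z\<^sup>r\<close>.\<close>

lemma jensen_nsum:
  fixes M :: real
  assumes r: "1 \<le> r" and M: "0 < M" "nsum w \<le> ennreal M"
  shows "ennpowr (nsum (\<lambda>i. w i * z i)) r
    \<le> ennreal (M powr (r - 1)) * nsum (\<lambda>i. w i * ennpowr (z i) r)"
proof (cases "r = 1")
  case True
  then show ?thesis using M by simp
next
  case False
  with r have r: "1 < r" by simp
  define S where "S = nsum (\<lambda>i. w i * ennpowr (z i) r)"
  have M': "ennreal (M powr (r - 1)) \<noteq> 0" using M by simp
  consider "S = top" | "S = 0" | t where "0 < t" "S = ennreal t"
    by (cases S) (auto simp: less_le)
  then show ?thesis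
  proof cases
    case 1
    then show ?thesis using M' by (simp add: S_def[symmetric] ennreal_mult_top)
  next
    case 2
    have wz: "w i * z i = 0" for i
      using le_nsum[of "\<lambda>i. w i * ennpowr (z i) r" i] 2 by (simp add: S_def[symmetric])
    show ?thesis by (simp only: wz) simp
  next
    case 3
    \<comment> \<open>The choice of \<open>a\<close> that makes the summed tangent bound exact.\<close>
    define a where "a = (t / M) powr (1/r)"
    have a: "0 < a" using 3 M by (simp add: a_def)
    have ar: "a powr r = t / M" using 3 M r by (simp add: a_def powr_powr)
    have tang: "z i \<le> ennreal (a powr (1 - r) / r) * ennpowr (z i) r + ennreal ((1 - 1/r) * a)" for i
    proof (cases "z i")
      case (real u)
      have "ennreal u \<le> ennreal (a powr (1 - r) / r * (u powr r) + (1 - 1/r) * a)"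
        using young_tangent[OF r real(1) a] by (intro ennreal_leI) (simp add: mult.commute)
      also have "\<dots> = ennreal (a powr (1 - r) / r) * ennreal (u powr r) + ennreal ((1 - 1/r) * a)"
      proof -
        have "0 \<le> a powr (1 - r) / r" "0 \<le> (1 - 1/r) * a" using r a by auto
        then show ?thesis by (simp only: ennreal_plus ennreal_mult' mult_nonneg_nonneg powr_ge_zero)
      qed
      finally show ?thesis using real by (simp add: ennpowr_ennreal)
    qed (use r a in \<open>simp add: ennreal_mult_top\<close>)
    have "nsum (\<lambda>i. w i * z i) \<le>
      nsum (\<lambda>i. ennreal (a powr (1 - r) / r) * (w i * ennpowr (z i) r) + ennreal ((1 - 1/r) * a) * w i)"
      using mult_left_mono[OF tang, of "w _"] by (intro nsum_mono) (simp add: algebra_simps)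
    also have "\<dots> = ennreal (a powr (1 - r) / r) * S + ennreal ((1 - 1/r) * a) * nsum w"
      by (simp add: nsum_add nsum_cmult S_def)
    also have "\<dots> \<le> ennreal (a powr (1 - r) / r) * S + ennreal ((1 - 1/r) * a) * ennreal M"
      using M by (intro add_left_mono mult_left_mono) auto
    also have "\<dots> = ennreal (a powr (1 - r) / r * t + (1 - 1/r) * a * M)"
    proof -
      have "0 \<le> a powr (1 - r) / r" "0 \<le> (1 - 1/r) * a" "0 \<le> t" "0 \<le> M" using 3 M r a by auto
      then show ?thesis using 3 by (simp only: ennreal_plus ennreal_mult' mult_nonneg_nonneg)
    qed
    also have "a powr (1 - r) / r * t + (1 - 1/r) * a * M = a * M"
    proof -
      have "a powr (1 - r) * t = a * M"
        using ar a M by (simp add: powr_diff field_simps)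
      then show ?thesis using r by (simp add: field_simps)
    qed
    finally have "nsum (\<lambda>i. w i * z i) \<le> ennreal (a * M)" .
    then have "ennpowr (nsum (\<lambda>i. w i * z i)) r \<le> ennpowr (ennreal (a * M)) r"
      using r by (intro ennpowr_mono) auto
    also have "\<dots> = ennreal (M powr (r - 1)) * S"
    proof -
      have "(a * M) powr r = M powr (r - 1) * t"
        using a M ar by (simp add: powr_mult powr_diff)
      moreover have "ennpowr (ennreal (a * M)) r = ennreal ((a * M) powr r)"
        using a M by (intro ennpowr_ennreal) auto
      ultimately show ?thesis using 3 by (simp add: ennreal_mult')
    qed
    finally show ?thesis by (simp add: S_def)
  qed
qed

section \<open>Sequence norms and a blockwise Schur test\<close>

text \<open>The \<open>\<ell>\<^sup>r\<close> norm, used for \<open>1 \<le> r \<le> \<infinity>\<close> only. It is applied to the \<open>p\<^sub>0\<close>-th powers of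
  absolute values, so that the quasi-norms of the statement become norms of exponent
  \<open>r = p / p\<^sub>0 \<ge> 1\<close>. Entries may be infinite, which spares summability side conditions.\<close>

definition lnorm :: "ennreal \<Rightarrow> ('i \<Rightarrow> ennreal) \<Rightarrow> ennreal" where
  "lnorm r x = (if r = top then (SUP i. x i)
     else ennpowr (nsum (\<lambda>i. ennpowr (x i) (enn2real r))) (1 / enn2real r))"

lemma lnorm_top: "lnorm top x = (SUP i. x i)"
  by (simp add: lnorm_def)

lemma lnorm_real:
  "1 \<le> r \<Longrightarrow> lnorm (ennreal r) x = ennpowr (nsum (\<lambda>i. ennpowr (x i) r)) (1 / r)"
  by (simp add: lnorm_def)

lemma lnorm_real_le_iff:
  "1 \<le> r \<Longrightarrow> lnorm (ennreal r) x \<le> b \<longleftrightarrow> nsum (\<lambda>i. ennpowr (x i) r) \<le> ennpowr b r"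
  by (simp add: lnorm_real ennpowr_inverse_le_iff)

lemma powr_lnorm_real:
  "1 \<le> r \<Longrightarrow> ennpowr (lnorm (ennreal r) x) r = nsum (\<lambda>i. ennpowr (x i) r)"
  by (simp add: lnorm_real ennpowr_ennpowr)

lemma exponent_cases:
  assumes "1 \<le> r"
  obtains "r = top" | t where "1 \<le> t" "r = ennreal t"
  using assms by (cases r) auto

lemma lnorm_mono:
  assumes "1 \<le> r" "\<And>i. x i \<le> y i"
  shows "lnorm r x \<le> lnorm r y"
  using assms(1)
proof (cases rule: exponent_cases)
  case 1
  then show ?thesis using assms(2) by (auto simp: lnorm_top intro!: SUP_mono)
next
  case (2 t)
  then show ?thesis using assms(2)
    by (auto simp: lnorm_real intro!: ennpowr_mono nsum_mono)
qed

lemma le_lnorm: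
  assumes "1 \<le> r"
  shows "x i \<le> lnorm r x"
  using assms
proof (cases rule: exponent_cases)
  case 1
  then show ?thesis by (auto simp: lnorm_top intro: SUP_upper)
next
  case (2 t)
  then show ?thesis using le_nsum[of "\<lambda>i. ennpowr (x i) t" i]
    by (simp add: lnorm_real ennpowr_le_inverse_iff)
qed

lemma lnorm_cmult:
  assumes "1 \<le> r"
  shows "lnorm r (\<lambda>i. a * x i) = a * lnorm r x"
  using assms
proof (cases rule: exponent_cases)
  case 1
  then show ?thesis by (simp add: lnorm_top SUP_mult_left_ennreal)
next
  case (2 t)
  then show ?thesis by (simp add: lnorm_real ennpowr_mult nsum_cmult ennpowr_ennpowr)
qed

lemma lnorm_le_nsum:
  assumes "1 \<le> r"
  shows "lnorm r x \<le> nsum x"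
  using assms
proof (cases rule: exponent_cases)
  case 1
  then show ?thesis by (auto simp: lnorm_top intro!: SUP_least le_nsum)
next
  case (2 t)
  then show ?thesis by (simp add: lnorm_real_le_iff nsum_powr_le)
qed

lemma lnorm_add_le:
  assumes "1 \<le> r"
  shows "lnorm r (\<lambda>i. x i + y i) \<le> 2 * (lnorm r x + lnorm r y)"
  using assms
proof (cases rule: exponent_cases)
  case 1
  have "(SUP i. x i + y i) \<le> lnorm r x + lnorm r y"
    using 1 by (intro SUP_least add_mono) (auto simp: lnorm_top intro: SUP_upper)
  also have "\<dots> \<le> 2 * (lnorm r x + lnorm r y)"
    by (simp add: mult_2)
  finally show ?thesis using 1 by (simp add: lnorm_top)
next
  case (2 t)
  have "nsum (\<lambda>i. ennpowr (x i + y i) t)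
      \<le> nsum (\<lambda>i. ennreal (2 powr t) * (ennpowr (x i) t + ennpowr (y i) t))"
    using 2 by (intro nsum_mono ennpowr_add_le) auto
  also have "\<dots> = ennpowr (ennreal 2) t * (nsum (\<lambda>i. ennpowr (x i) t) + nsum (\<lambda>i. ennpowr (y i) t))"
    by (simp add: nsum_cmult nsum_add ennpowr_ennreal del: ennreal_numeral)
  also have "\<dots> = ennpowr (ennreal 2) t * (ennpowr (lnorm r x) t + ennpowr (lnorm r y) t)"
    using 2 by (simp add: powr_lnorm_real)
  also have "\<dots> \<le> ennpowr (ennreal 2) t * ennpowr (lnorm r x + lnorm r y) t"
    using 2 nsum_powr_le[of t "\<lambda>b. if b then lnorm r x else lnorm r y"]
    by (intro mult_left_mono) (auto simp: nn_integral_count_space_finite UNIV_bool add.commute)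
  also have "\<dots> = ennpowr (2 * (lnorm r x + lnorm r y)) t"
    using 2 by (subst ennpowr_mult) auto
  finally show ?thesis using 2 by (simp add: lnorm_real_le_iff)
qed

text \<open>A Schur test that keeps track of blocks. The index set of the columns is divided into blocks
  \<open>h = j\<close>, and \<open>V j\<close> bounds the row sums of \<open>K\<close> within block \<open>j\<close> as well as its full column
  sums there. Summing over the blocks by Minkowski and applying the ordinary Schur test in each would
  prove it; here both happen at once. Each entry of \<open>x\<close> is divided by the norm of its
  block, and Jensen's inequality is applied with the weights \<open>K l i\<close> times these norms: a
  row has total weight at most \<open>B\<close>, the right-hand side, and each block of the quotient has
  norm at most \<open>1\<close>.\<close>

lemma lnorm_block_schur:
  fixes K :: "'a \<Rightarrow> 'b \<Rightarrow> ennreal" and h :: "'b \<Rightarrow> 'c"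
  assumes r: "1 \<le> r"
    and fin: "\<And>j. lnorm r (\<lambda>i. x i * indicator {i. h i = j} i) < top"
    and row: "\<And>l j. nsum (\<lambda>i. K l i * indicator {i. h i = j} i) \<le> V j"
    and col: "\<And>i. nsum (\<lambda>l. K l i) \<le> V (h i)"
  shows "lnorm r (\<lambda>l. nsum (\<lambda>i. K l i * x i))
    \<le> nsum (\<lambda>j. V j * lnorm r (\<lambda>i. x i * indicator {i. h i = j} i))"
    (is "_ \<le> nsum (\<lambda>j. V j * ?U j)")
proof -
  define B where "B = nsum (\<lambda>j. V j * ?U j)"
  have x_le: "x i \<le> ?U (h i)" for i
    using le_lnorm[OF r, of "\<lambda>i'. x i' * indicator {i'. h i' = h i} i'" i] by simp
  have rowB: "nsum (\<lambda>i. K l i * ?U (h i)) \<le> B" for l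
  proof -
    have "nsum (\<lambda>i. K l i * ?U (h i))
        = nsum (\<lambda>j. nsum (\<lambda>i. K l i * ?U (h i) * indicator {i. h i = j} i))"
      by (rule nsum_partition)
    also have "\<dots> = nsum (\<lambda>j. nsum (\<lambda>i. K l i * indicator {i. h i = j} i) * ?U j)"
      by (simp only: nsum_multc[symmetric])
        (intro nn_integral_cong, auto split: split_indicator)
    also have "\<dots> \<le> B"
      unfolding B_def by (intro nsum_mono mult_right_mono row) auto
    finally show ?thesis .
  qed
  show ?thesis
    using r
  proof (cases rule: exponent_cases)
    case 1
    have "nsum (\<lambda>i. K l i * x i) \<le> B" for l
      by (rule order_trans[OF nsum_mono rowB[of l]]) (intro mult_left_mono x_le, simp)
    then show ?thesis
      using 1 by (auto simp: lnorm_top B_def intro!: SUP_least)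
  next
    case (2 t)
    consider "B = top" | "B = 0" | b where "0 < b" "B = ennreal b"
      by (cases B) (auto simp: less_le)
    then show ?thesis
    proof cases
      case 1
      then show ?thesis by (simp add: B_def)
    next
      case 2
      have Kx: "K l i * x i = 0" for l i
        using rowB[of l] le_nsum[of "\<lambda>i. K l i * ?U (h i)" i] x_le[of i] 2 by auto
      show ?thesis
        unfolding Kx using lnorm_le_nsum[OF r, of "\<lambda>_::'a. 0"] by simp
    next
      case 3
      define z where "z i = x i / ?U (h i)" for i
      have Uz: "?U (h i) * z i = x i" for i
      proof (cases "?U (h i) = 0")
        case True
        then show ?thesis using x_le[of i] by simp
      next
        case False
        then show ?thesis using fin[of "h i"]
          by (simp add: z_def ennreal_times_divide ennreal_mult_divide_eq mult.commute)
      qed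
      have block: "?U j * nsum (\<lambda>i. ennpowr (z i) t * indicator {i. h i = j} i) \<le> ?U j" for j
      proof (cases "?U j = 0")
        case False
        have pt: "ennpowr (?U j) t * (ennpowr (z i) t * indicator {i. h i = j} i)
          = ennpowr (x i * indicator {i. h i = j} i) t" for i
          using 2 Uz[of i, symmetric] by (auto simp: ennpowr_mult split: split_indicator)
        have "ennpowr (?U j) t * nsum (\<lambda>i. ennpowr (z i) t * indicator {i. h i = j} i)
            = nsum (\<lambda>i. ennpowr (x i * indicator {i. h i = j} i) t)"
          by (simp only: nsum_cmult[symmetric] pt)
        also have "\<dots> = ennpowr (?U j) t"
          using 2 by (simp add: powr_lnorm_real)
        finally have "nsum (\<lambda>i. ennpowr (z i) t * indicator {i. h i = j} i) = 1"
          using False fin[of j] ennreal_mult_cancel_left[of "ennpowr (?U j) t" _ 1] by auto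
        then show ?thesis by simp
      qed simp
      have "nsum (\<lambda>l. ennpowr (nsum (\<lambda>i. K l i * x i)) t)
          = nsum (\<lambda>l. ennpowr (nsum (\<lambda>i. (K l i * ?U (h i)) * z i)) t)"
        by (simp add: mult.assoc Uz)
      also have "\<dots> \<le> nsum (\<lambda>l. ennreal (b powr (t - 1)) *
            nsum (\<lambda>i. K l i * ?U (h i) * ennpowr (z i) t))"
        using rowB 2 3 by (intro nsum_mono jensen_nsum) auto
      also have "\<dots> = ennreal (b powr (t - 1)) *
            nsum (\<lambda>i. nsum (\<lambda>l. K l i * (?U (h i) * ennpowr (z i) t)))"
        by (simp only: nsum_cmult mult.assoc nsum_swap[of "\<lambda>l i. K l i * (?U (h i) * ennpowr (z i) t)"])
      also have "\<dots> \<le> ennreal (b powr (t - 1)) * nsum (\<lambda>i. V (h i) * (?U (h i) * ennpowr (z i) t))"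
        unfolding nsum_multc by (intro mult_left_mono nsum_mono mult_right_mono col) auto
      also have "nsum (\<lambda>i. V (h i) * (?U (h i) * ennpowr (z i) t))
          = nsum (\<lambda>j. nsum (\<lambda>i. V (h i) * (?U (h i) * ennpowr (z i) t) * indicator {i. h i = j} i))"
        by (rule nsum_partition)
      also have "\<dots> = nsum (\<lambda>j. V j * (?U j * nsum (\<lambda>i. ennpowr (z i) t * indicator {i. h i = j} i)))"
        by (simp only: nsum_cmult[symmetric])
          (intro nn_integral_cong, auto split: split_indicator)
      also have "ennreal (b powr (t - 1)) * \<dots> \<le> ennreal (b powr (t - 1)) * B"
        unfolding B_def by (intro mult_left_mono nsum_mono block) auto
      also have "\<dots> = ennpowr B t"
      proof -
        have "b powr (t - 1) * b = b powr t" using 3 by (simp add: powr_diff)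
        then show ?thesis using 3 by (simp add: ennpowr_ennreal ennreal_mult[symmetric])
      qed
      finally show ?thesis using 2 by (simp add: lnorm_real_le_iff B_def)
    qed
  qed
qed

text \<open>The ordinary Schur test is the case of a single block. Its constant does not
  depend on \<open>r\<close>, and this is the source of the uniformity in the theorem.\<close>

lemma lnorm_schur:
  fixes M :: ennreal
  assumes r: "1 \<le> r" and M: "0 < M"
    and row: "\<And>l. nsum (\<lambda>i. K l i) \<le> M"
    and col: "\<And>i. nsum (\<lambda>l. K l i) \<le> M"
  shows "lnorm r (\<lambda>l. nsum (\<lambda>i. K l i * x i)) \<le> M * lnorm r x"
proof (cases "lnorm r x = top")
  case True
  then show ?thesis using M by (simp add: ennreal_mult_top)
next
  case False
  then show ?thesis
    using lnorm_block_schur[OF r, where h = "\<lambda>_. ()" and V = "\<lambda>_. M" and K = K and x = x] row col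
    by (simp add: nn_integral_count_space_finite UNIV_unit top.not_eq_extremum)
qed

section \<open>The quasi-norms and sums of the statement\<close>

text \<open>The delicate inequality bounds the integral by the supremum of the finite sums. If that
  supremum is finite, the terms form a summable real family, for which both sides are known to agree.\<close>

lemma infsum_eq_nsum:
  fixes f :: "'i \<Rightarrow> ennreal"
  shows "infsum f I = nsum (\<lambda>i. indicator I i * f i)"
proof (rule antisym)
  have sup: "infsum f I = (SUP F\<in>{F. finite F \<and> F \<subseteq> I}. sum f F)"
    by (rule nonneg_infsum_complete) simp
  have sum_eq: "sum f F = nsum (\<lambda>i. indicator F i * f i)" if "finite F" for F
    using that by (subst nn_integral_count_space'[of F]) (auto split: split_indicator)
  show "infsum f I \<le> nsum (\<lambda>i. indicator I i * f i)"
    unfolding sup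
    by (intro SUP_least) (auto simp: sum_eq intro!: nsum_mono mult_right_mono indicator_leI)
  show "nsum (\<lambda>i. indicator I i * f i) \<le> infsum f I"
  proof (cases "infsum f I")
    case (real b)
    have le: "sum f F \<le> ennreal b" if "finite F" "F \<subseteq> I" for F
      unfolding real(2)[symmetric] sup using that by (intro SUP_upper) auto
    have fin: "f i < top" if "i \<in> I" for i
      using le[of "{i}"] that by (auto simp: le_less_trans)
    define g where "g i = enn2real (f i)" for i
    have g: "f i = ennreal (g i)" if "i \<in> I" for i
      using fin[OF that] by (simp add: g_def)
    have "sum g F \<le> b" if "finite F" "F \<subseteq> I" for F
    proof -
      have "ennreal (sum g F) = (\<Sum>i\<in>F. ennreal (g i))"
        by (simp add: g_def)
      also have "\<dots> = sum f F"
        using that by (intro sum.cong) (auto simp: g)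
      finally show ?thesis using le[OF that] real(1) by (metis ennreal_le_iff)
    qed
    then have summ: "g summable_on I"
      by (intro nonneg_bdd_above_summable_on) (auto simp: g_def intro!: bdd_aboveI)
    then have "Infinite_Set_Sum.abs_summable_on g I"
      by (simp add: g_def[abs_def] flip: abs_summable_equivalent)
    then have "nn_integral (count_space I) (\<lambda>i. ennreal (g i)) = ennreal (infsetsum g I)"
      by (intro nn_integral_conv_infsetsum) (auto simp: g_def)
    also have "\<dots> = ennreal (infsum g I)"
      using \<open>Infinite_Set_Sum.abs_summable_on g I\<close> by (simp add: infsetsum_infsum)
    also have "\<dots> \<le> infsum f I"
    proof -
      have "infsum g I \<le> b"
        using summ \<open>\<And>F. finite F \<Longrightarrow> F \<subseteq> I \<Longrightarrow> sum g F \<le> b\<close> by (rule infsum_le_finite_sums)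
      then show ?thesis using real by (simp add: ennreal_leI)
    qed
    finally have "nn_integral (count_space I) (\<lambda>i. ennreal (g i)) \<le> infsum f I" .
    also have "nn_integral (count_space I) (\<lambda>i. ennreal (g i)) = nsum (\<lambda>i. indicator I i * f i)"
      by (subst nn_integral_count_space_indicator)
        (auto intro!: nn_integral_cong simp: g mult.commute split: split_indicator)
    finally show ?thesis .
  qed simp
qed

lemma one_le_exponent_ratio:
  assumes "0 < s" "ennreal s \<le> p"
  shows "1 \<le> p / ennreal s"
  using divide_right_mono_ennreal[OF assms(2), of "ennreal s"] assms(1) by simp

lemma lp_norm_eq_lnorm:
  assumes "0 < s" "ennreal s \<le> p"
  shows "ennpowr (lp_norm p I c) s
    = lnorm (p / ennreal s) (\<lambda>i. indicator I i * ennpowr (ennreal (cmod (c i))) s)"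
proof (cases p)
  case (real t)
  with assms have t: "0 < t" "s \<le> t" "1 \<le> t / s" by auto
  have pt: "p / ennreal s = ennreal (t / s)"
    using real t assms by (simp add: divide_ennreal)
  have eq: "ennpowr (indicator I i * ennpowr (ennreal (cmod (c i))) s) (t / s)
      = indicator I i * ennreal (cmod (c i) powr t)" for i
    using t assms by (auto simp: ennpowr_ennreal powr_powr split: split_indicator)
  show ?thesis
    unfolding pt lnorm_real[OF t(3)] eq
    using real t by (simp add: lp_norm_def infsum_eq_nsum ennpowr_ennpowr)
next
  case top
  have "(SUP i. indicator I i * ennpowr (ennreal (cmod (c i))) s) = (SUP i\<in>I. ennpowr (ennreal (cmod (c i))) s)"
    by (rule antisym; rule SUP_least)
      (auto split: split_indicator intro: SUP_upper intro!: SUP_upper2)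
  then show ?thesis
    using top assms
    by (simp add: lp_norm_def ennpowr_SUP ennreal_top_divide lnorm_top)
qed

lemma abs_summable_onI_nsum:
  fixes z :: "'i \<Rightarrow> complex"
  assumes "nsum (\<lambda>i. indicator I i * ennreal (cmod (z i))) < top"
  shows "(\<lambda>i. norm (z i)) summable_on I"
proof -
  have "(\<integral>\<^sup>+ i. ennreal (cmod (z i)) \<partial>count_space I) < top"
    using assms by (subst nn_integral_count_space_indicator) (auto simp: mult.commute)
  then have "Infinite_Set_Sum.abs_summable_on z I"
    by (simp add: Infinite_Set_Sum.abs_summable_on_def integrable_iff_bounded)
  then show ?thesis by (simp flip: abs_summable_equivalent)
qed

lemma norm_infsum_le_nsum:
  fixes z :: "'i \<Rightarrow> complex"
  shows "ennreal (cmod (infsum z I)) \<le> nsum (\<lambda>i. indicator I i * ennreal (cmod (z i)))"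
proof (cases "(\<lambda>i. norm (z i)) summable_on I")
  case True
  have "ennreal (cmod (infsum z I)) \<le> ennreal (infsum (\<lambda>i. norm (z i)) I)"
    using True by (intro ennreal_leI norm_infsum_bound) 
  also have "\<dots> = infsum (\<lambda>i. ennreal (norm (z i))) I"
    using True infsum_nonneg_is_SUPREMUM_ennreal[of "\<lambda>i. norm (z i)" I]
    by (simp add: nonneg_infsum_complete)
  finally show ?thesis by (simp add: infsum_eq_nsum)
next
  case False
  then have "nsum (\<lambda>i. indicator I i * ennreal (cmod (z i))) = top"
    using abs_summable_onI_nsum[of I z] by (auto simp flip: top.not_eq_extremum)
  then show ?thesis
    by simp
qed

section \<open>Lattice cells and relatively separated sets\<close>

definition lattice_cell :: "real \<Rightarrow> real ^ 'd \<Rightarrow> int ^ 'd" where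
  "lattice_cell \<delta> x = (\<chi> i. \<lfloor>x $ i / \<delta>\<rfloor>)"

definition lattice_point :: "real \<Rightarrow> int ^ 'd \<Rightarrow> real ^ 'd" where
  "lattice_point \<delta> k = (\<chi> i. \<delta> * of_int (k $ i))"

lemma norm_le_card_bound:
  fixes x :: "real ^ 'd"
  assumes "\<And>i. \<bar>x $ i\<bar> \<le> b"
  shows "norm x \<le> real CARD('d) * b"
proof -
  have "norm x \<le> (\<Sum>i\<in>UNIV. \<bar>x $ i\<bar>)"
    by (rule norm_le_l1_cart)
  also have "\<dots> \<le> (\<Sum>i\<in>(UNIV::'d set). b)"
    by (intro sum_mono assms)
  finally show ?thesis by simp
qed

lemma cell_component:
  assumes "0 < \<delta>"
  shows "\<delta> * of_int (lattice_cell \<delta> x $ i) \<le> x $ i"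
    "x $ i < \<delta> * of_int (lattice_cell \<delta> x $ i) + \<delta>"
proof -
  have "of_int \<lfloor>x $ i / \<delta>\<rfloor> \<le> x $ i / \<delta>" "x $ i / \<delta> < of_int \<lfloor>x $ i / \<delta>\<rfloor> + 1"
    by linarith+
  then show "\<delta> * of_int (lattice_cell \<delta> x $ i) \<le> x $ i"
    "x $ i < \<delta> * of_int (lattice_cell \<delta> x $ i) + \<delta>"
    using assms
      mult_left_mono[of "of_int \<lfloor>x $ i / \<delta>\<rfloor>" "x $ i / \<delta>" \<delta>]
      mult_strict_left_mono[of "x $ i / \<delta>" "of_int \<lfloor>x $ i / \<delta>\<rfloor> + 1" \<delta>]
    by (auto simp: lattice_cell_def distrib_left)
qed

text \<open>The dimension enters because distances are Euclidean while cells are cubes.\<close>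

lemma norm_diff_lattice_point:
  fixes x :: "real ^ 'd"
  assumes "0 < \<delta>"
  shows "norm (x - lattice_point \<delta> (lattice_cell \<delta> x)) \<le> real CARD('d) * \<delta>"
proof (rule norm_le_card_bound)
  fix i
  show "\<bar>(x - lattice_point \<delta> (lattice_cell \<delta> x)) $ i\<bar> \<le> \<delta>"
    using cell_component[OF assms, of x i] by (simp add: lattice_point_def)
qed

lemma cell_subset_cball:
  fixes j :: "int ^ 'd"
  assumes "0 < T"
  shows "{y. lattice_cell T y = j} \<subseteq> cball (lattice_point T j) ((real CARD('d) + 1) * T)"
proof
  fix y :: "real ^ 'd" assume "y \<in> {y. lattice_cell T y = j}"
  then have "norm (y - lattice_point T j) \<le> real CARD('d) * T"
    using norm_diff_lattice_point[OF assms, of y] by simp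
  also have "\<dots> \<le> (real CARD('d) + 1) * T" using assms by simp
  finally show "y \<in> cball (lattice_point T j) ((real CARD('d) + 1) * T)"
    by (simp add: dist_norm norm_minus_commute)
qed

lemma norm_diff_same_cell:
  fixes x y :: "real ^ 'd"
  assumes "0 < \<delta>" "lattice_cell \<delta> x = lattice_cell \<delta> y"
  shows "norm (x - y) \<le> real CARD('d) * \<delta>"
proof (rule norm_le_card_bound)
  fix i
  show "\<bar>(x - y) $ i\<bar> \<le> \<delta>"
    using cell_component[OF assms(1), of x i] cell_component[OF assms(1), of y i] assms(2)
    by (simp add: abs_le_iff)
qed

lemma nsum_indicator: "nsum (indicator S) = emeasure (count_space UNIV) S"
  by simp

lemma finite_int_vec_box: "finite {k :: int ^ 'd. \<forall>i. k $ i \<in> B}" if "finite B"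
proof -
  have "{k :: int ^ 'd. \<forall>i. k $ i \<in> B} \<subseteq> vec_lambda ` (PiE UNIV (\<lambda>_. B))"
  proof
    fix k :: "int ^ 'd" assume "k \<in> {k. \<forall>i. k $ i \<in> B}"
    then show "k \<in> vec_lambda ` (PiE UNIV (\<lambda>_. B))"
      by (intro image_eqI[of _ _ "vec_nth k"]) auto
  qed
  then show ?thesis
    by (rule finite_subset) (intro finite_imageI finite_PiE finite that)
qed

text \<open>The bound depends on \<open>D\<close> and the dimension but not on the scale \<open>T\<close>: this lets the number of
  overlapping cells be fixed before \<open>T\<close> is chosen.\<close>

lemma lattice_points_near:
  fixes D :: real
  obtains K :: real where "0 < K"
    "\<And>(T::real) (z::real ^ 'd). 0 < T \<Longrightarrow>
      nsum (indicator {k. norm (z - lattice_point T k) \<le> D * T}) \<le> ennreal K"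
proof -
  define R where "R = \<lceil>D\<rceil> + 1"
  define B where "B = {k :: int ^ 'd. \<forall>i. k $ i \<in> {-R..R}}"
  have B: "finite B" unfolding B_def by (rule finite_int_vec_box) simp
  have "nsum (indicator {k. norm (z - lattice_point T k) \<le> D * T}) \<le> ennreal (real (card B) + 1)"
    if T: "0 < T" for T and z :: "real ^ 'd"
  proof -
    let ?S = "{k. norm (z - lattice_point T k) \<le> D * T}"
    have "?S \<subseteq> (\<lambda>b. b + lattice_cell T z) ` B"
    proof
      fix k assume k: "k \<in> ?S"
      have "(k - lattice_cell T z) $ i \<in> {-R..R}" for i
      proof -
        have "\<bar>(z - lattice_point T k) $ i\<bar> \<le> D * T"
          using k component_le_norm_cart[of "z - lattice_point T k" i] by simp
        then have "\<bar>z $ i / T - of_int (k $ i)\<bar> \<le> D"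
          using T by (simp add: lattice_point_def abs_le_iff field_simps)
        then show ?thesis
          unfolding R_def lattice_cell_def by simp linarith
      qed
      then show "k \<in> (\<lambda>b. b + lattice_cell T z) ` B"
        by (intro image_eqI[of _ _ "k - lattice_cell T z"]) (auto simp: B_def)
    qed
    then have "finite ?S" "card ?S \<le> card B"
      using B by (auto intro: finite_subset surj_card_le)
    then show ?thesis
      by (simp add: nsum_indicator ennreal_of_nat_eq_real_of_nat ennreal_leI del: ennreal_plus)
  qed
  then show ?thesis
    by (intro that[of "real (card B) + 1"]) auto
qed

lemma count_le_rel: "nsum (indicator (\<Lambda> \<inter> ball x 1)) \<le> rel \<Lambda>"
  unfolding rel_def nsum_indicator by (rule SUP_upper) simp

text \<open>A ball of radius \<open>R\<close> is covered by finitely many unit balls, and their number is the same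
  for all centres.\<close>

lemma separated_points_near:
  fixes \<Lambda> :: "(real ^ 'd) set"
  assumes "relatively_separated \<Lambda>"
  obtains C :: real where "0 < C"
    "\<And>x. nsum (indicator (\<Lambda> \<inter> cball x R)) \<le> ennreal C"
proof -
  have "compact (cball (0::real ^ 'd) R)" by simp
  moreover have "cball (0::real ^ 'd) R \<subseteq> (\<Union>f\<in>cball 0 R. ball f 1)"
    by (auto intro!: bexI)
  ultimately obtain F where F: "finite F" "cball (0::real ^ 'd) R \<subseteq> (\<Union>f\<in>F. ball f 1)"
    by (meson compactE_image open_ball)
  define N where "N = enn2real (rel \<Lambda>)"
  have N: "rel \<Lambda> = ennreal N" "0 \<le> N"
    using assms by (auto simp: N_def relatively_separated_def)
  have "nsum (indicator (\<Lambda> \<inter> cball x R)) \<le> ennreal (real (card F) * N + 1)" for x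
  proof -
    have "\<Lambda> \<inter> cball x R \<subseteq> (\<Union>f\<in>F. \<Lambda> \<inter> ball (x + f) 1)"
    proof
      fix y assume y: "y \<in> \<Lambda> \<inter> cball x R"
      then have "y - x \<in> cball 0 R" by (simp add: dist_norm norm_minus_commute)
      then obtain f where "f \<in> F" "y - x \<in> ball f 1" using F by blast
      then show "y \<in> (\<Union>f\<in>F. \<Lambda> \<inter> ball (x + f) 1)"
        using y by (auto simp: dist_norm algebra_simps intro!: bexI[of _ f])
    qed
    then have "emeasure (count_space UNIV) (\<Lambda> \<inter> cball x R)
        \<le> emeasure (count_space UNIV) (\<Union>f\<in>F. \<Lambda> \<inter> ball (x + f) 1)"
      by (intro emeasure_mono) auto
    also have "\<dots> \<le> (\<Sum>f\<in>F. emeasure (count_space UNIV) (\<Lambda> \<inter> ball (x + f) 1))"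
      by (intro emeasure_subadditive_finite F) auto
    also have "\<dots> \<le> (\<Sum>f\<in>F. rel \<Lambda>)"
      by (intro sum_mono) (metis count_le_rel nsum_indicator)
    also have "\<dots> = ennreal (real (card F) * N)"
      using N by (simp add: ennreal_mult' ennreal_of_nat_eq_real_of_nat)
    also have "\<dots> \<le> ennreal (real (card F) * N + 1)"
      by (intro ennreal_leI) simp
    finally show ?thesis by (simp only: nsum_indicator)
  qed
  moreover have "0 < real (card F) * N + 1" using N by (simp add: add_nonneg_pos)
  ultimately show ?thesis using that by blast
qed

section \<open>Envelopes\<close>

text \<open>For a continuous function the essential supremum over an open ball dominates every value: an
  open set on which the function is larger would be null, hence empty.\<close>

lemma norm_le_Linf_norm_on_ball:
  fixes H :: "real ^ 'd \<Rightarrow> real"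
  assumes cont: "continuous_on UNIV H" and y: "y \<in> ball x 1"
  shows "ennreal (norm (H y)) \<le> Linf_norm_on (ball x 1) H"
proof (rule ccontr)
  let ?M = "restrict_space lborel (ball x 1)"
  assume "\<not> ?thesis"
  then have less: "Linf_norm_on (ball x 1) H < ennreal (norm (H y))" by simp
  then obtain l where l: "0 \<le> l" "Linf_norm_on (ball x 1) H = ennreal l"
    by (cases "Linf_norm_on (ball x 1) H") auto
  define S where "S = ball x 1 \<inter> {z. l < norm (H z)}"
  have "open S"
    unfolding S_def by (intro open_Int open_ball open_Collect_less continuous_intros cont)
  moreover have "y \<in> S"
    using less l y by (simp add: S_def ennreal_less_iff)
  ultimately have "\<not> negligible S"
    using open_not_negligible by blast
  moreover have "negligible S"
  proof -
    have "AE z in ?M. ennreal (norm (H z)) \<le> ennreal l"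
      using esssup_AE[of "\<lambda>z. ennreal (norm (H z))" ?M] l by (simp add: Linf_norm_on_def)
    then have "AE z in lborel. z \<in> ball x 1 \<longrightarrow> norm (H z) \<le> l"
      using l by (subst (asm) AE_restrict_space_iff) auto
    then have "AE z in lborel. z \<notin> S"
      by eventually_elim (auto simp: S_def)
    moreover have "S \<in> sets lborel" using \<open>open S\<close> by simp
    ultimately have "S \<in> null_sets lborel"
      by (subst AE_iff_null_sets) auto
    then show ?thesis
      by (simp add: negligible_iff_null_sets null_sets_completionI)
  qed
  ultimately show False by simp
qed

text \<open>A side length for which every cell has diameter less than \<open>1\<close>, hence lies in the unit ball
  about each of its points.\<close>

definition mesh :: "'d itself \<Rightarrow> real" where
  "mesh _ = 1 / (real CARD('d) + 1)"

lemma mesh: "0 < mesh TYPE('d::finite)" "real CARD('d) * mesh TYPE('d::finite) < 1"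
  by (auto simp: mesh_def)

abbreviation fine_cell :: "real ^ 'd \<Rightarrow> int ^ 'd" where
  "fine_cell \<equiv> lattice_cell (mesh TYPE('d))"

abbreviation fine_point :: "int ^ 'd \<Rightarrow> real ^ 'd" where
  "fine_point \<equiv> lattice_point (mesh TYPE('d))"

definition cell_sup :: "real \<Rightarrow> (real ^ 'd \<Rightarrow> real) \<Rightarrow> int ^ 'd \<Rightarrow> ennreal" where
  "cell_sup s H m = (SUP y\<in>{y. fine_cell y = m}. ennpowr (ennreal (norm (H y))) s)"

lemma le_cell_sup: "ennpowr (ennreal (norm (H y))) s \<le> cell_sup s H (fine_cell y)"
  unfolding cell_sup_def by (rule SUP_upper) simp

lemma emeasure_lattice_cell:
  fixes m :: "int ^ 'd"
  assumes "0 < \<delta>"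
  shows "ennreal (\<delta> ^ CARD('d)) \<le> emeasure lborel {x. lattice_cell \<delta> x = m}"
    and "{x. lattice_cell \<delta> x = m} \<in> sets borel"
proof -
  show meas: "{x. lattice_cell \<delta> x = m} \<in> sets borel"
  proof -
    have "{x. lattice_cell \<delta> x = m} = (\<Inter>i. {x. \<lfloor>x $ i / \<delta>\<rfloor> = m $ i})"
      by (auto simp: lattice_cell_def vec_eq_iff)
    also have "\<dots> \<in> sets borel"
    proof (intro sets.countable_INT'')
      fix i :: 'd
      have "(\<lambda>x :: real ^ 'd. \<lfloor>x $ i / \<delta>\<rfloor>) \<in> borel \<rightarrow>\<^sub>M count_space UNIV"
        by measurable
      from measurable_sets[OF this, of "{m $ i}"] show "{x :: real ^ 'd. \<lfloor>x $ i / \<delta>\<rfloor> = m $ i} \<in> sets borel"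
        by (simp add: vimage_def)
    qed auto
    finally show ?thesis .
  qed
  define l :: "real ^ 'd" where "l = lattice_point \<delta> m"
  define u :: "real ^ 'd" where "u = l + (\<chi> i. \<delta>)"
  have ul: "(u - l) \<bullet> b = \<delta>" if "b \<in> Basis" for b
    using that by (auto simp: u_def Basis_vec_def inner_axis)
  then have "l \<bullet> b \<le> u \<bullet> b" if "b \<in> Basis" for b
    using that assms by (metis diff_ge_0_iff_ge inner_diff_left less_imp_le)
  then have "ennreal (\<delta> ^ CARD('d)) = emeasure lborel (box l u)"
    using ul by (simp add: emeasure_lborel_box)
  also have "\<dots> \<le> emeasure lborel {x. lattice_cell \<delta> x = m}"
  proof (rule emeasure_mono)
    show "box l u \<subseteq> {x. lattice_cell \<delta> x = m}"
    proof
      fix x assume "x \<in> box l u"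
      then have "\<delta> * of_int (m $ i) < x $ i \<and> x $ i < \<delta> * of_int (m $ i) + \<delta>" for i
        by (auto simp: mem_box_cart l_def u_def lattice_point_def)
      then have "\<lfloor>x $ i / \<delta>\<rfloor> = m $ i" for i
        using assms by (intro floor_unique) (auto simp: field_simps less_imp_le)
      then show "x \<in> {x. lattice_cell \<delta> x = m}"
        by (simp add: lattice_cell_def vec_eq_iff)
    qed
  qed (use meas in simp)
  finally show "ennreal (\<delta> ^ CARD('d)) \<le> emeasure lborel {x. lattice_cell \<delta> x = m}" .
qed

lemma countable_int_vec: "countable (UNIV :: (int ^ 'd) set)"
proof -
  have "UNIV = (\<Union>n::nat. {k :: int ^ 'd. \<forall>i. k $ i \<in> {-int n..int n}})"
  proof -
    have "\<exists>n. \<forall>i. k $ i \<in> {-int n..int n}" for k :: "int ^ 'd"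
    proof -
      have "\<bar>k $ i\<bar> \<le> (\<Sum>i\<in>UNIV. \<bar>k $ i\<bar>)" for i
        by (intro member_le_sum) auto
      then have "k $ i \<in> {- int (nat (\<Sum>i\<in>UNIV. \<bar>k $ i\<bar>))..int (nat (\<Sum>i\<in>UNIV. \<bar>k $ i\<bar>))}" for i
        by (auto simp: abs_le_iff sum_nonneg minus_le_iff)
      then show ?thesis by blast
    qed
    then show ?thesis by auto
  qed
  also have "countable \<dots>"
    by (rule countable_UN[OF countableI_type]) (intro countable_finite finite_int_vec_box, simp)
  finally show ?thesis .
qed

text \<open>Discretization of the amalgam norm. The supremum of the envelope over a fine cell is at most its
  essential supremum over the unit ball about any point of that cell. Integrating this over the
  cells, which have equal positive volume, bounds the sum of the cell suprema.\<close>

lemma nsum_cell_sup_finite: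
  fixes H :: "real ^ 'd \<Rightarrow> real"
  assumes s: "0 < s" and H: "H \<in> wiener_amalgam s"
  shows "nsum (cell_sup s H) < top"
proof -
  let ?\<delta> = "mesh TYPE('d)"
  let ?L = "\<lambda>x. ennpowr (Linf_norm_on (ball x 1) H) s"
  have cont: "continuous_on UNIV H"
    using H by (simp add: wiener_amalgam_def bcontfun_def)
  have ptwise: "cell_sup s H (fine_cell x) \<le> ?L x" for x
    unfolding cell_sup_def
  proof (rule SUP_least)
    fix y assume "y \<in> {y. fine_cell y = fine_cell x}"
    then have "y \<in> ball x 1"
      using norm_diff_same_cell[of ?\<delta> x y] mesh[where 'd = 'd] by (simp add: dist_norm)
    then show "ennpowr (ennreal (norm (H y))) s \<le> ?L x"
      using s by (intro ennpowr_mono norm_le_Linf_norm_on_ball cont) auto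
  qed
  have cell_sets: "{x :: real ^ 'd. fine_cell x = m} \<in> sets lborel" for m
    using emeasure_lattice_cell(2)[OF mesh(1)] by simp
  have "ennreal (?\<delta> ^ CARD('d)) * nsum (cell_sup s H)
      = nsum (\<lambda>m. cell_sup s H m * ennreal (?\<delta> ^ CARD('d)))"
    by (simp add: nsum_multc mult.commute)
  also have "\<dots> \<le> nsum (\<lambda>m. cell_sup s H m * emeasure lborel {x. fine_cell x = m})"
    by (intro nsum_mono mult_left_mono emeasure_lattice_cell mesh) auto
  also have "\<dots> = nsum (\<lambda>m. \<integral>\<^sup>+ x. cell_sup s H m * indicator {x. fine_cell x = m} x \<partial>lborel)"
    using cell_sets
    by (intro nn_integral_cong nn_integral_cmult_indicator[symmetric]) auto
  also have "\<dots> = (\<integral>\<^sup>+ x. nsum (\<lambda>m. cell_sup s H m * indicator {x. fine_cell x = m} x) \<partial>lborel)"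
    by (intro nn_integral_count_space_nn_integral[symmetric] countable_int_vec
        borel_measurable_times_ennreal borel_measurable_const borel_measurable_indicator)
      (use cell_sets in simp)
  also have "\<dots> = (\<integral>\<^sup>+ x. cell_sup s H (fine_cell x) \<partial>lborel)"
  proof (intro nn_integral_cong)
    fix x :: "real ^ 'd"
    have "nsum (\<lambda>m. cell_sup s H m * indicator {x. fine_cell x = m} x)
        = nsum (\<lambda>m. cell_sup s H m * indicator {fine_cell x} m)"
      by (intro nn_integral_cong) (auto split: split_indicator)
    then show "nsum (\<lambda>m. cell_sup s H m * indicator {x. fine_cell x = m} x) = cell_sup s H (fine_cell x)"
      by (simp add: nsum_single)
  qed
  also have "\<dots> \<le> (\<integral>\<^sup>+ x. ?L x \<partial>lborel)"
    by (intro nn_integral_mono ptwise)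
  also have "\<dots> < top"
    using H by (simp add: wiener_amalgam_def amalgam_norm_def)
  finally have "ennreal (?\<delta> ^ CARD('d)) * nsum (cell_sup s H) < top" .
  then show ?thesis
    using mesh(1)[where 'd = 'd] by (auto simp: ennreal_mult_less_top)
qed

text \<open>A fine cell is met at most \<open>rel \<Lambda>\<close> times.\<close>

lemma nsum_over_separated:
  fixes \<phi> :: "real ^ 'd \<Rightarrow> real ^ 'd" and F :: "int ^ 'd \<Rightarrow> ennreal"
  assumes "\<And>m. {y. fine_cell (\<phi> y) = m} \<subseteq> ball (z m) 1"
  shows "nsum (\<lambda>y. indicator \<Lambda> y * F (fine_cell (\<phi> y))) \<le> rel \<Lambda> * nsum F"
proof -
  have "nsum (\<lambda>y. indicator \<Lambda> y * F (fine_cell (\<phi> y)))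
      = nsum (\<lambda>m. nsum (\<lambda>y. indicator \<Lambda> y * F (fine_cell (\<phi> y)) * indicator {y. fine_cell (\<phi> y) = m} y))"
    by (rule nsum_partition)
  also have "\<dots> \<le> nsum (\<lambda>m. nsum (\<lambda>y. indicator (\<Lambda> \<inter> ball (z m) 1) y * F m))"
  proof (intro nsum_mono)
    fix m y
    show "indicator \<Lambda> y * F (fine_cell (\<phi> y)) * indicator {y. fine_cell (\<phi> y) = m} y
        \<le> indicator (\<Lambda> \<inter> ball (z m) 1) y * F m"
      using assms[of m] by (cases "y \<in> {y. fine_cell (\<phi> y) = m}") (auto split: split_indicator)
  qed
  also have "\<dots> = nsum (\<lambda>m. nsum (indicator (\<Lambda> \<inter> ball (z m) 1)) * F m)"
    by (simp only: nsum_multc)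
  also have "\<dots> \<le> nsum (\<lambda>m. rel \<Lambda> * F m)"
    by (intro nsum_mono mult_right_mono count_le_rel) simp
  finally show ?thesis by (simp only: nsum_cmult)
qed

lemma norm_diff_fine_point:
  fixes x :: "real ^ 'd"
  shows "norm (x - fine_point (fine_cell x)) < 1"
  using norm_diff_lattice_point[of "mesh TYPE('d)" x] mesh[where 'd='d] by simp

lemma nsum_row_bound:
  "nsum (\<lambda>y. indicator \<Gamma> y * F (fine_cell (x - y))) \<le> rel \<Gamma> * nsum F"
proof (rule nsum_over_separated[where z = "\<lambda>m. x - fine_point m"])
  fix m
  have "y \<in> ball (x - fine_point (fine_cell (x - y))) 1" for y
    using norm_diff_fine_point[of "x - y"]
    by (simp add: dist_norm norm_minus_commute diff_diff_eq add.commute)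
  then show "{y. fine_cell (x - y) = m} \<subseteq> ball (x - fine_point m) 1"
    by auto
qed

lemma nsum_column_bound:
  "nsum (\<lambda>x. indicator \<Lambda> x * F (fine_cell (x - y))) \<le> rel \<Lambda> * nsum F"
proof (rule nsum_over_separated[where z = "\<lambda>m. y + fine_point m"])
  fix m
  have "x \<in> ball (y + fine_point (fine_cell (x - y))) 1" for x
    using norm_diff_fine_point[of "x - y"]
    by (simp add: dist_norm norm_minus_commute diff_diff_eq)
  then show "{x. fine_cell (x - y) = m} \<subseteq> ball (y + fine_point m) 1"
    by auto
qed

text \<open>An upper bound on cell \<open>m\<close> for the \<open>s\<close>-th power of \<open>min 1 (norm x / T)\<close>, the variation of a
  bump of width \<open>T\<close> between two points with difference \<open>x\<close>.\<close>

definition damping :: "real \<Rightarrow> real \<Rightarrow> int ^ 'd \<Rightarrow> ennreal" where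
  "damping s T m = ennreal (min 1 ((norm (fine_point m) + 1) / T) powr s)"

text \<open>Dominated convergence: for every fixed cell the damping factor tends to \<open>0\<close> as
  \<open>T\<close> grows. No rate is available, so the constants that \<open>\<eta>\<close> has to beat may not depend
  on \<open>T\<close>.\<close>

lemma damped_sum_small:
  fixes g :: "int ^ 'd \<Rightarrow> ennreal"
  assumes s: "0 < s" and g: "nsum g < top" and \<eta>: "0 < \<eta>"
  obtains T :: real where "1 \<le> T" "nsum (\<lambda>m. damping s T m * g m) \<le> ennreal \<eta>"
proof -
  have "(\<lambda>n. nsum (\<lambda>m. damping s (real n) m * g m)) \<longlonglongrightarrow> nsum (\<lambda>m::int ^ 'd. 0)"
  proof (rule nn_integral_dominated_convergence[where w = g])
    show "AE m in count_space UNIV. damping s (real n) m * g m \<le> g m" for n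
    proof (rule AE_I2)
      fix m :: "int ^ 'd"
      have "min 1 ((norm (fine_point m) + 1) / real n) powr s \<le> 1"
        using s by (intro powr_le1) auto
      then have "damping s (real n) m \<le> 1"
        unfolding damping_def by (simp add: ennreal_le_1)
      then show "damping s (real n) m * g m \<le> g m"
        using mult_right_mono[of "damping s (real n) m" 1 "g m"] by simp
    qed
    show "AE m in count_space UNIV. (\<lambda>n. damping s (real n) m * g m) \<longlonglongrightarrow> 0"
    proof (rule AE_I2)
      fix m :: "int ^ 'd"
      have "g m < top" using le_nsum[of g m] g by (rule le_less_trans)
      moreover have "(\<lambda>n. damping s (real n) m) \<longlonglongrightarrow> ennreal (min 1 0 powr s)"
        unfolding damping_def using s
        by (intro tendsto_ennrealI tendsto_powr' tendsto_min tendsto_const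
            tendsto_divide_0[OF tendsto_const] filterlim_at_top_imp_at_infinity
            filterlim_real_sequentially) auto
      ultimately have "(\<lambda>n. damping s (real n) m * g m) \<longlonglongrightarrow> ennreal (min 1 0 powr s) * g m"
        by (intro tendsto_mult_ennreal tendsto_const) auto
      then show "(\<lambda>n. damping s (real n) m * g m) \<longlonglongrightarrow> 0" by simp
    qed
  qed (use g in auto)
  then have "(\<lambda>n. nsum (\<lambda>m. damping s (real n) m * g m)) \<longlonglongrightarrow> 0" by simp
  then have "eventually (\<lambda>n. nsum (\<lambda>m. damping s (real n) m * g m) < ennreal \<eta>) sequentially"
    using \<eta> by (intro order_tendstoD) auto
  then have "eventually (\<lambda>n. nsum (\<lambda>m. damping s (real n) m * g m) < ennreal \<eta> \<and> 1 \<le> n) sequentially"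
    by (intro eventually_conj eventually_ge_at_top)
  then obtain n where "nsum (\<lambda>m. damping s (real n) m * g m) < ennreal \<eta>" "1 \<le> n"
    using eventually_happens'[OF sequentially_bot] by blast
  then show ?thesis
    by (intro that[of "real n"]) auto
qed

section \<open>Bump functions and the commutator kernel\<close>

text \<open>A tent of slope \<open>1/T\<close> with a plateau wide enough to contain the whole cell \<open>k\<close> of
  side \<open>T\<close>.\<close>

definition bump :: "real \<Rightarrow> int ^ 'd \<Rightarrow> real ^ 'd \<Rightarrow> real" where
  "bump T k x = max 0 (min 1 (real CARD('d) + 1 - norm (x - lattice_point T k) / T))"

lemma bump_bounds: "0 \<le> bump T k x" "bump T k x \<le> 1"
  by (auto simp: bump_def)

lemma bump_on_cell: "0 < T \<Longrightarrow> bump T (lattice_cell T x) x = 1"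
  using norm_diff_lattice_point[of T x] by (simp add: bump_def pos_divide_le_eq)

lemma bump_support:
  fixes x :: "real ^ 'd"
  assumes "0 < T" "bump T k x \<noteq> 0"
  shows "norm (x - lattice_point T k) \<le> (real CARD('d) + 1) * T"
proof -
  have "norm (x - lattice_point T k) / T \<le> real CARD('d) + 1"
    using assms(2) by (auto simp: bump_def max_def min_def split: if_splits)
  then show ?thesis using assms(1) by (simp add: pos_divide_le_eq)
qed

lemma bump_lipschitz:
  assumes "0 < T"
  shows "\<bar>bump T k x - bump T k y\<bar> \<le> min 1 (norm (x - y) / T)"
proof -
  define a where "a = norm (x - lattice_point T k) / T"
  define b where "b = norm (y - lattice_point T k) / T"
  have "\<bar>norm (x - lattice_point T k) - norm (y - lattice_point T k)\<bar> \<le> norm (x - y)"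
    using norm_triangle_ineq3[of "x - lattice_point T k" "y - lattice_point T k"] by simp
  then have "\<bar>a - b\<bar> \<le> norm (x - y) / T"
    using assms by (simp add: a_def b_def abs_le_iff field_simps)
  then show ?thesis
    unfolding bump_def a_def[symmetric] b_def[symmetric] by (auto simp: max_def min_def)
qed

text \<open>Up to the number of points in a unit ball, the sum over \<open>m\<close> bounds the norm of the commutator of the
  matrix with bump \<open>k\<close>, restricted to columns in cell \<open>j\<close>. The indicator retains what the support of
  the bump allows: either the cells \<open>k\<close> and \<open>j\<close> are neighbours, or the row index lies near
  cell \<open>k\<close>, and then the difference of the indices is close to the difference of the cells.\<close>

definition block_weight ::
    "real \<Rightarrow> (real ^ 'd \<Rightarrow> real) \<Rightarrow> real \<Rightarrow> int ^ 'd \<Rightarrow> int ^ 'd \<Rightarrow> int ^ 'd \<Rightarrow> ennreal" where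
  "block_weight s H T k j m = damping s T m * cell_sup s H m *
     indicator {m. norm (lattice_point T k - lattice_point T j) \<le> (2 * real CARD('d) + 2) * T \<or>
       norm (fine_point m - (lattice_point T k - lattice_point T j)) \<le> (2 * real CARD('d) + 2) * T} m"

text \<open>If the bump vanishes at both points there is nothing to prove. Otherwise one of them lies in
  its support. If it is \<open>y\<close>, the cell of \<open>y\<close> is a neighbour of \<open>k\<close>; if it is \<open>x\<close>, then
  \<open>x - y\<close> is located near the difference of the two lattice points. The error of at most \<open>1\<close> made
  in replacing \<open>x - y\<close> by its fine lattice point is absorbed by \<open>1 \<le> T\<close>.\<close>

lemma commutator_le_block_weight:
  fixes x y :: "real ^ 'd"
  assumes s: "0 < s" and T: "1 \<le> T"
  shows "ennpowr (ennreal (norm (H (x - y)))) s * ennreal (\<bar>bump T k y - bump T k x\<bar> powr s)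
    \<le> block_weight s H T k (lattice_cell T y) (fine_cell (x - y))"
proof (cases "bump T k y = 0 \<and> bump T k x = 0")
  case False
  let ?d = "real CARD('d)" and ?m = "fine_cell (x - y)" and ?j = "lattice_cell T y"
  have T0: "0 < T" using T by simp
  have fine: "norm (x - y - fine_point ?m) < 1"
    by (rule norm_diff_fine_point)
  have y_cell: "norm (y - lattice_point T ?j) \<le> ?d * T"
    by (rule norm_diff_lattice_point[OF T0])
  have near: "norm (lattice_point T k - lattice_point T ?j) \<le> (2 * ?d + 2) * T \<or>
       norm (fine_point ?m - (lattice_point T k - lattice_point T ?j)) \<le> (2 * ?d + 2) * T"
  proof (cases "bump T k y = 0")
    case False
    have "norm (lattice_point T k - lattice_point T ?j)
        \<le> norm (y - lattice_point T k) + norm (y - lattice_point T ?j)"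
      using norm_triangle_ineq4[of "y - lattice_point T ?j" "y - lattice_point T k"] by simp
    also have "\<dots> \<le> (?d + 1) * T + ?d * T"
      by (intro add_mono bump_support[OF T0 False] y_cell)
    also have "\<dots> \<le> (2 * ?d + 2) * T"
      using T0 by (simp add: algebra_simps)
    finally show ?thesis ..
  next
    case True
    with False have x_supp: "norm (x - lattice_point T k) \<le> (?d + 1) * T"
      by (intro bump_support[OF T0]) auto
    have eq: "fine_point ?m - (lattice_point T k - lattice_point T ?j)
        = (x - lattice_point T k) - (y - lattice_point T ?j) - (x - y - fine_point ?m)"
      by simp
    have "norm (fine_point ?m - (lattice_point T k - lattice_point T ?j))
        \<le> norm (x - lattice_point T k) + norm (y - lattice_point T ?j) + norm (x - y - fine_point ?m)"
      unfolding eq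
      using norm_triangle_ineq4[of "(x - lattice_point T k) - (y - lattice_point T ?j)" "x - y - fine_point ?m"]
        norm_triangle_ineq4[of "x - lattice_point T k" "y - lattice_point T ?j"] by linarith
    also have "\<dots> \<le> (?d + 1) * T + ?d * T + T"
      using fine T by (intro add_mono x_supp y_cell) auto
    also have "\<dots> = (2 * ?d + 2) * T"
      by (simp add: algebra_simps)
    finally show ?thesis ..
  qed
  have "\<bar>bump T k y - bump T k x\<bar> \<le> min 1 (norm (x - y) / T)"
    using bump_lipschitz[OF T0, of k y x] by (simp add: norm_minus_commute)
  also have "\<dots> \<le> min 1 ((norm (fine_point ?m) + 1) / T)"
  proof -
    have "norm (x - y) \<le> norm (fine_point ?m) + 1"
      using fine norm_triangle_sub[of "x - y" "fine_point ?m"] by simp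
    then have "norm (x - y) / T \<le> (norm (fine_point ?m) + 1) / T"
      using T0 by (simp add: divide_right_mono)
    then show ?thesis by (auto simp: min_def)
  qed
  finally have "ennreal (\<bar>bump T k y - bump T k x\<bar> powr s) \<le> damping s T ?m"
    using s unfolding damping_def by (intro ennreal_leI powr_mono2) auto
  then have "ennpowr (ennreal (norm (H (x - y)))) s * ennreal (\<bar>bump T k y - bump T k x\<bar> powr s)
      \<le> cell_sup s H ?m * damping s T ?m"
    by (intro mult_mono le_cell_sup) auto
  then show ?thesis
    using near by (simp add: block_weight_def mult.commute)
qed simp

text \<open>For a fixed fine cell \<open>m\<close>, either alternative in the block weight confines \<open>j\<close> (or \<open>k\<close>)
  to at most \<open>K\<close> values. Exchanging the sums leaves the damped envelope sum, whose smallness is thus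
  inherited by the row and column sums of the block weights.\<close>

lemma block_weight_sums:
  fixes H :: "real ^ 'd \<Rightarrow> real"
  assumes T: "0 < T"
    and K: "\<And>z::real ^ 'd. nsum (indicator {k. norm (z - lattice_point T k) \<le> (2 * real CARD('d) + 2) * T})
      \<le> ennreal K"
  shows "nsum (\<lambda>j. nsum (block_weight s H T k j))
      \<le> 2 * ennreal K * nsum (\<lambda>m. damping s T m * cell_sup s H m)" (is "?row \<le> _")
    and "nsum (\<lambda>k. nsum (block_weight s H T k j))
      \<le> 2 * ennreal K * nsum (\<lambda>m. damping s T m * cell_sup s H m)" (is "?col \<le> _")
proof -
  let ?R = "(2 * real CARD('d) + 2) * T"
  let ?w = "\<lambda>m. damping s T m * cell_sup s H m"
  let ?I = "\<lambda>z. indicator {k. norm (z - lattice_point T k) \<le> ?R} :: int ^ 'd \<Rightarrow> ennreal"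
  have two: "nsum (\<lambda>i. nsum (W i)) \<le> 2 * ennreal K * nsum ?w"
    if W: "\<And>i m. W i m \<le> (?I z i + ?I (z' m) i) * ?w m" for W z z'
  proof -
    have "nsum (\<lambda>i. nsum (W i)) = nsum (\<lambda>m. nsum (\<lambda>i. W i m))"
      by (rule nsum_swap)
    also have "\<dots> \<le> nsum (\<lambda>m. nsum (\<lambda>i. (?I z i + ?I (z' m) i) * ?w m))"
      by (intro nsum_mono W)
    also have "\<dots> = nsum (\<lambda>m. (nsum (?I z) + nsum (?I (z' m))) * ?w m)"
      by (simp only: nsum_multc nsum_add)
    also have "\<dots> \<le> nsum (\<lambda>m. (ennreal K + ennreal K) * ?w m)"
      by (intro nsum_mono mult_right_mono add_mono K) auto
    finally show ?thesis
      by (simp only: nsum_cmult mult_2)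
  qed
  show "?row \<le> 2 * ennreal K * nsum ?w"
  proof (rule two)
    fix j m
    have "norm (lattice_point T k - fine_point m - lattice_point T j)
        = norm (fine_point m - (lattice_point T k - lattice_point T j))"
      by (subst norm_minus_commute) (simp add: algebra_simps)
    then show "block_weight s H T k j m
        \<le> (?I (lattice_point T k) j + ?I (lattice_point T k - fine_point m) j) * ?w m"
      unfolding block_weight_def
      by (subst mult.commute) (intro mult_right_mono, auto split: split_indicator)
  qed
  show "?col \<le> 2 * ennreal K * nsum ?w"
  proof (rule two)
    fix k m
    have "norm (fine_point m + lattice_point T j - lattice_point T k)
        = norm (fine_point m - (lattice_point T k - lattice_point T j))"
      by (simp add: algebra_simps)
    moreover have "norm (lattice_point T k - lattice_point T j) = norm (lattice_point T j - lattice_point T k)"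
      by (rule norm_minus_commute)
    ultimately show "block_weight s H T k j m
        \<le> (?I (lattice_point T j) k + ?I (fine_point m + lattice_point T j) k) * ?w m"
      unfolding block_weight_def
      by (subst mult.commute) (intro mult_right_mono, auto split: split_indicator)
  qed
qed

section \<open>Localizing the matrix\<close>

lemma ennpowr_subadd:
  assumes "0 < s" "s \<le> 1"
  shows "ennpowr (x + y) s \<le> ennpowr x s + ennpowr y s"
  using powr_nsum_le[OF assms, of "\<lambda>b. if b then x else y"]
  by (simp add: nn_integral_count_space_finite UNIV_bool add.commute)

text \<open>Needed for the absolute convergence of the sums that define the matrix action on bounded
  sequences.\<close>

lemma nsum_envelope:
  assumes "0 < s"
  shows "nsum (\<lambda>y. indicator \<Gamma> y * ennpowr (ennreal (norm (H (x - y)))) s)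
    \<le> rel \<Gamma> * nsum (cell_sup s H)"
proof -
  have "nsum (\<lambda>y. indicator \<Gamma> y * ennpowr (ennreal (norm (H (x - y)))) s)
      \<le> nsum (\<lambda>y. indicator \<Gamma> y * cell_sup s H (fine_cell (x - y)))"
    by (intro nsum_mono mult_left_mono le_cell_sup) auto
  also have "\<dots> \<le> rel \<Gamma> * nsum (cell_sup s H)"
    by (rule nsum_row_bound)
  finally show ?thesis .
qed

text \<open>Multiplication by the bump is moved past the matrix: \<open>A (\<psi> c) = \<psi> (A c) + [A, \<psi>] c\<close>, where the
  commutator has the entries \<open>a\<^bsub>x y\<^esub> (\<psi> y - \<psi> x)\<close>. Both terms are then estimated through
  \<open>s\<close>-th powers.\<close>

lemma mat_apply_bump_le:
  fixes A :: "real ^ 'd \<Rightarrow> real ^ 'd \<Rightarrow> complex"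
  assumes s: "0 < s" "s \<le> 1" and \<Gamma>: "rel \<Gamma> < top" and g: "nsum (cell_sup s H) < top"
    and A: "\<And>y. y \<in> \<Gamma> \<Longrightarrow> cmod (A x y) \<le> norm (H (x - y))"
    and c: "\<And>y. y \<in> \<Gamma> \<Longrightarrow> ennpowr (ennreal (cmod (c y))) s \<le> b" "b < top"
  shows "ennpowr (ennreal (cmod (mat_apply A \<Gamma> (\<lambda>y. of_real (bump T k y) * c y) x))) s
    \<le> ennpowr (ennreal (bump T k x * cmod (mat_apply A \<Gamma> c x))) s
      + nsum (\<lambda>y. indicator \<Gamma> y * (ennpowr (ennreal (norm (H (x - y)))) s
          * ennreal (\<bar>bump T k y - bump T k x\<bar> powr s)) * ennpowr (ennreal (cmod (c y))) s)"
proof -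
  let ?z = "\<lambda>y. A x y * c y"
  let ?\<psi> = "bump T k"
  have Az: "ennpowr (ennreal (cmod (A x y))) s \<le> ennpowr (ennreal (norm (H (x - y)))) s"
    if "y \<in> \<Gamma>" for y
    using A[OF that] s by (intro ennpowr_mono ennreal_leI) auto
  have "ennpowr (nsum (\<lambda>y. indicator \<Gamma> y * ennreal (cmod (?z y)))) s
      \<le> nsum (\<lambda>y. ennpowr (indicator \<Gamma> y * ennreal (cmod (?z y))) s)"
    by (rule powr_nsum_le[OF s])
  also have "\<dots> \<le> nsum (\<lambda>y. indicator \<Gamma> y * ennpowr (ennreal (norm (H (x - y)))) s * b)"
    using s Az c(1)
    by (intro nsum_mono)
      (auto simp: norm_mult ennreal_mult ennpowr_mult split: split_indicator intro!: mult_mono)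
  also have "\<dots> \<le> rel \<Gamma> * nsum (cell_sup s H) * b"
    unfolding nsum_multc by (intro mult_right_mono nsum_envelope s) simp
  also have "\<dots> < top"
    using \<Gamma> g c(2) by (simp add: ennreal_mult_less_top)
  finally have abs: "(\<lambda>y. norm (?z y)) summable_on \<Gamma>"
    by (intro abs_summable_onI_nsum) simp
  then have summ: "?z summable_on \<Gamma>"
    by (rule abs_summable_summable)
  have summ': "(\<lambda>y. of_real (?\<psi> y - ?\<psi> x) * ?z y) summable_on \<Gamma>"
  proof (rule abs_summable_summable, rule Infinite_Sum.abs_summable_on_comparison_test[OF abs])
    fix y
    have "\<bar>?\<psi> y - ?\<psi> x\<bar> \<le> 1"
      using bump_bounds[of T k y] bump_bounds[of T k x] by linarith
    then have "\<bar>?\<psi> y - ?\<psi> x\<bar> * norm (?z y) \<le> 1 * norm (?z y)"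
      by (rule mult_right_mono) simp
    then show "norm (of_real (?\<psi> y - ?\<psi> x) * ?z y) \<le> norm (?z y)"
      by (simp only: norm_mult norm_of_real mult_1)
  qed
  have "infsum (\<lambda>y. A x y * (of_real (?\<psi> y) * c y)) \<Gamma> =
      infsum (\<lambda>y. of_real (?\<psi> x) * ?z y + of_real (?\<psi> y - ?\<psi> x) * ?z y) \<Gamma>"
    by (intro infsum_cong) (simp add: algebra_simps)
  also have "\<dots> = of_real (?\<psi> x) * infsum ?z \<Gamma> + infsum (\<lambda>y. of_real (?\<psi> y - ?\<psi> x) * ?z y) \<Gamma>"
    using summ summ' by (subst infsum_add) (auto intro: summable_on_cmult_right simp: infsum_cmult_right)
  finally have "mat_apply A \<Gamma> (\<lambda>y. of_real (?\<psi> y) * c y) x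
      = of_real (?\<psi> x) * mat_apply A \<Gamma> c x + infsum (\<lambda>y. of_real (?\<psi> y - ?\<psi> x) * ?z y) \<Gamma>"
    by (simp add: mat_apply_def)
  then have "cmod (mat_apply A \<Gamma> (\<lambda>y. of_real (?\<psi> y) * c y) x)
      \<le> cmod (of_real (?\<psi> x) * mat_apply A \<Gamma> c x) + cmod (infsum (\<lambda>y. of_real (?\<psi> y - ?\<psi> x) * ?z y) \<Gamma>)"
    by (simp only: norm_triangle_ineq)
  also have "cmod (of_real (?\<psi> x) * mat_apply A \<Gamma> c x) = ?\<psi> x * cmod (mat_apply A \<Gamma> c x)"
    using bump_bounds(1)[of T k x] by (simp add: norm_mult)
  finally have "cmod (mat_apply A \<Gamma> (\<lambda>y. of_real (?\<psi> y) * c y) x)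
      \<le> ?\<psi> x * cmod (mat_apply A \<Gamma> c x) + cmod (infsum (\<lambda>y. of_real (?\<psi> y - ?\<psi> x) * ?z y) \<Gamma>)"
    .
  then have "ennreal (cmod (mat_apply A \<Gamma> (\<lambda>y. of_real (?\<psi> y) * c y) x))
      \<le> ennreal (?\<psi> x * cmod (mat_apply A \<Gamma> c x))
        + ennreal (cmod (infsum (\<lambda>y. of_real (?\<psi> y - ?\<psi> x) * ?z y) \<Gamma>))"
    using bump_bounds(1)[of T k x]
    by (subst ennreal_plus[symmetric]) (simp_all del: ennreal_plus add: ennreal_leI)
  also have "\<dots> \<le> ennreal (?\<psi> x * cmod (mat_apply A \<Gamma> c x))
        + nsum (\<lambda>y. indicator \<Gamma> y * ennreal (cmod (of_real (?\<psi> y - ?\<psi> x) * ?z y)))"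
    by (intro add_left_mono norm_infsum_le_nsum)
  finally have "ennpowr (ennreal (cmod (mat_apply A \<Gamma> (\<lambda>y. of_real (?\<psi> y) * c y) x))) s
      \<le> ennpowr (ennreal (?\<psi> x * cmod (mat_apply A \<Gamma> c x))
        + nsum (\<lambda>y. indicator \<Gamma> y * ennreal (cmod (of_real (?\<psi> y - ?\<psi> x) * ?z y)))) s"
    using s by (intro ennpowr_mono) auto
  also have "\<dots> \<le> ennpowr (ennreal (?\<psi> x * cmod (mat_apply A \<Gamma> c x))) s
        + nsum (\<lambda>y. ennpowr (indicator \<Gamma> y * ennreal (cmod (of_real (?\<psi> y - ?\<psi> x) * ?z y))) s)"
    by (rule order_trans[OF ennpowr_subadd[OF s]]) (intro add_left_mono powr_nsum_le s)
  also have "\<dots> \<le> ennpowr (ennreal (?\<psi> x * cmod (mat_apply A \<Gamma> c x))) s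
        + nsum (\<lambda>y. indicator \<Gamma> y * (ennpowr (ennreal (norm (H (x - y)))) s
          * ennreal (\<bar>?\<psi> y - ?\<psi> x\<bar> powr s)) * ennpowr (ennreal (cmod (c y))) s)"
  proof (intro add_left_mono nsum_mono)
    fix y
    have "ennpowr (ennreal (cmod (of_real (?\<psi> y - ?\<psi> x) * ?z y))) s
        \<le> (ennpowr (ennreal (norm (H (x - y)))) s * ennreal (\<bar>?\<psi> y - ?\<psi> x\<bar> powr s))
          * ennpowr (ennreal (cmod (c y))) s" if y: "y \<in> \<Gamma>"
    proof -
      have "ennpowr (ennreal (cmod (of_real (?\<psi> y - ?\<psi> x) * ?z y))) s
          = (ennpowr (ennreal (cmod (A x y))) s * ennreal (\<bar>?\<psi> y - ?\<psi> x\<bar> powr s))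
            * ennpowr (ennreal (cmod (c y))) s"
      proof -
        have "cmod (of_real (?\<psi> y - ?\<psi> x) * ?z y) = \<bar>?\<psi> y - ?\<psi> x\<bar> * (cmod (A x y) * cmod (c y))"
          by (simp only: norm_mult norm_of_real)
        then have "ennpowr (ennreal (cmod (of_real (?\<psi> y - ?\<psi> x) * ?z y))) s
          = ennpowr (ennreal \<bar>?\<psi> y - ?\<psi> x\<bar>) s
            * (ennpowr (ennreal (cmod (A x y))) s * ennpowr (ennreal (cmod (c y))) s)"
          using s by (simp only: ennreal_mult norm_ge_zero abs_ge_zero mult_nonneg_nonneg ennpowr_mult)
        also have "ennpowr (ennreal \<bar>?\<psi> y - ?\<psi> x\<bar>) s = ennreal (\<bar>?\<psi> y - ?\<psi> x\<bar> powr s)"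
          by (rule ennpowr_ennreal) simp
        finally show ?thesis by (simp only: mult_ac)
      qed
      then show ?thesis
        using Az[OF y] by (simp add: mult_right_mono)
    qed
    then show "ennpowr (indicator \<Gamma> y * ennreal (cmod (of_real (?\<psi> y - ?\<psi> x) * ?z y))) s
        \<le> indicator \<Gamma> y * (ennpowr (ennreal (norm (H (x - y)))) s
          * ennreal (\<bar>?\<psi> y - ?\<psi> x\<bar> powr s)) * ennpowr (ennreal (cmod (c y))) s"
      by (cases "y \<in> \<Gamma>") (simp_all only: indicator_simps mult_1 mult_zero_left ennpowr_0 order_refl simp_thms)
  qed
  finally show ?thesis .
qed

text \<open>The hypothesis at the exponent \<open>p\<close> is used on the localized sequence \<open>\<psi> c\<close>, which is
  finitely supported and therefore lies in \<open>\<ell>\<^sup>p\<close> for any bounded \<open>c\<close>. The result bounds the local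
  norm \<open>U k\<close> on cell \<open>k\<close> by the nearby values of \<open>A c\<close> and an average of all the local norms. The
  commutator is controlled by the block Schur test with the cells as blocks. The sum of the
  nearby values of \<open>A c\<close> is larger than their \<open>\<ell>\<^sup>r\<close> norm; this costs a factor depending
  on \<open>T\<close>, which is allowed since no smallness is required of that term.\<close>

lemma local_lower_bound:
  fixes A :: "real ^ 'd \<Rightarrow> real ^ 'd \<Rightarrow> complex"
  assumes s: "0 < s" "s \<le> 1" and p: "ennreal s \<le> p" and T: "1 \<le> T" and C0: "0 < C0"
    and \<Lambda>: "relatively_separated \<Lambda>" and \<Gamma>: "relatively_separated \<Gamma>"
    and g: "nsum (cell_sup s H) < top"
    and A: "\<And>x y. x \<in> \<Lambda> \<Longrightarrow> y \<in> \<Gamma> \<Longrightarrow> cmod (A x y) \<le> norm (H (x - y))"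
    and lower: "\<And>c. c \<in> lp p \<Gamma> \<Longrightarrow> ennreal C0 * lp_norm p \<Gamma> c \<le> lp_norm p \<Lambda> (mat_apply A \<Gamma> c)"
    and c: "\<And>y. y \<in> \<Gamma> \<Longrightarrow> ennpowr (ennreal (cmod (c y))) s \<le> b" "b < top"
    and u: "\<And>y. u y = indicator \<Gamma> y * ennpowr (ennreal (cmod (c y))) s"
    and v: "\<And>x. v x = indicator \<Lambda> x * ennpowr (ennreal (cmod (mat_apply A \<Gamma> c x))) s"
    and U: "\<And>j. U j = lnorm (p / ennreal s) (\<lambda>y. u y * indicator {y. lattice_cell T y = j} y)"
  shows "ennreal (C0 powr s) * U k
    \<le> 2 * (nsum (\<lambda>x. indicator (\<Lambda> \<inter> cball (lattice_point T k) ((real CARD('d) + 1) * T)) x * v x)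
      + nsum (\<lambda>j. (rel \<Lambda> + rel \<Gamma>) * nsum (block_weight s H T k j) * U j))"
proof -
  let ?r = "p / ennreal s" and ?d = "real CARD('d)" and ?\<psi> = "bump T k"
  let ?S = "\<lambda>k. cball (lattice_point T k) ((?d + 1) * T)"
  let ?c' = "\<lambda>y. of_real (?\<psi> y) * c y"
  let ?u' = "\<lambda>y. indicator \<Gamma> y * ennpowr (ennreal (cmod (?c' y))) s"
  let ?v' = "\<lambda>x. indicator \<Lambda> x * ennpowr (ennreal (cmod (mat_apply A \<Gamma> ?c' x))) s"
  let ?K = "\<lambda>x y. indicator \<Lambda> x * (indicator \<Gamma> y * (ennpowr (ennreal (norm (H (x - y)))) s
          * ennreal (\<bar>?\<psi> y - ?\<psi> x\<bar> powr s)))"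
  let ?V = "\<lambda>j. (rel \<Lambda> + rel \<Gamma>) * nsum (block_weight s H T k j)"
  have T0: "0 < T" using T by simp
  have r: "1 \<le> ?r"
    by (rule one_le_exponent_ratio[OF s(1) p])
  note norm_eq = lp_norm_eq_lnorm[OF s(1) p]
  have ball_sum: "nsum (\<lambda>y. indicator (\<Gamma> \<inter> ?S j) y * b) < top" for j
  proof -
    obtain C where "0 < C" "\<And>x. nsum (indicator (\<Gamma> \<inter> cball x ((?d + 1) * T))) \<le> ennreal C"
      using separated_points_near[OF \<Gamma>] by metis
    then show ?thesis
      using c(2) by (simp only: nsum_multc) (metis ennreal_less_top ennreal_mult_less_top le_less_trans)
  qed
  have finU: "lnorm ?r (\<lambda>y. u y * indicator {y. lattice_cell T y = j} y) < top" for j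
  proof -
    have "lnorm ?r (\<lambda>y. u y * indicator {y. lattice_cell T y = j} y)
        \<le> nsum (\<lambda>y. u y * indicator {y. lattice_cell T y = j} y)"
      by (rule lnorm_le_nsum[OF r])
    also have "\<dots> \<le> nsum (\<lambda>y. indicator (\<Gamma> \<inter> ?S j) y * b)"
      using c(1) subsetD[OF cell_subset_cball[OF T0, of j]] by (intro nsum_mono) (auto simp: u split: split_indicator)
    finally show ?thesis using ball_sum by (rule le_less_trans)
  qed
  have c'_le: "ennpowr (ennreal (cmod (?c' y))) s \<le> ennpowr (ennreal (cmod (c y))) s" for y
    using s bump_bounds[of T k y]
    by (intro ennpowr_mono ennreal_leI) (auto simp: norm_mult mult_left_le_one_le)
  have "?c' \<in> lp p \<Gamma>"
  proof -
    have "ennpowr (lp_norm p \<Gamma> ?c') s \<le> nsum ?u'"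
      unfolding norm_eq by (rule lnorm_le_nsum[OF r])
    also have "\<dots> \<le> nsum (\<lambda>y. indicator (\<Gamma> \<inter> ?S k) y * b)"
    proof (intro nsum_mono)
      fix y
      show "?u' y \<le> indicator (\<Gamma> \<inter> ?S k) y * b"
      proof (cases "y \<in> \<Gamma> \<and> ?\<psi> y \<noteq> 0")
        case True
        then have "y \<in> ?S k"
          using bump_support[OF T0, of k y] by (simp add: dist_norm norm_minus_commute)
        then show ?thesis using True c'_le[of y] c(1)[of y] by auto
      qed auto
    qed
    also have "\<dots> < top" by (rule ball_sum)
    finally show ?thesis by (simp add: lp_def)
  qed
  then have "ennpowr (ennreal C0 * lp_norm p \<Gamma> ?c') s \<le> ennpowr (lp_norm p \<Lambda> (mat_apply A \<Gamma> ?c')) s"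
    using lower s by (intro ennpowr_mono) auto
  then have main: "ennreal (C0 powr s) * lnorm ?r ?u' \<le> lnorm ?r ?v'"
    using s C0 by (simp add: ennpowr_mult norm_eq ennpowr_ennreal)
  have "U k \<le> lnorm ?r ?u'"
    unfolding U
  proof (rule lnorm_mono[OF r])
    fix y
    show "u y * indicator {y. lattice_cell T y = k} y \<le> ?u' y"
      using bump_on_cell[OF T0, of y] by (auto simp: u split: split_indicator)
  qed
  then have "ennreal (C0 powr s) * U k \<le> ennreal (C0 powr s) * lnorm ?r ?u'"
    by (rule mult_left_mono) simp
  also note main
  also have "lnorm ?r ?v' \<le> lnorm ?r (\<lambda>x. indicator (\<Lambda> \<inter> ?S k) x * v x + nsum (\<lambda>y. ?K x y * u y))"
  proof (rule lnorm_mono[OF r])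
    fix x
    show "?v' x \<le> indicator (\<Lambda> \<inter> ?S k) x * v x + nsum (\<lambda>y. ?K x y * u y)"
    proof (cases "x \<in> \<Lambda>")
      case True
      have "?v' x = ennpowr (ennreal (cmod (mat_apply A \<Gamma> ?c' x))) s"
        using True by simp
      also have "\<dots> \<le> ennpowr (ennreal (?\<psi> x * cmod (mat_apply A \<Gamma> c x))) s
        + nsum (\<lambda>y. indicator \<Gamma> y * (ennpowr (ennreal (norm (H (x - y)))) s
          * ennreal (\<bar>?\<psi> y - ?\<psi> x\<bar> powr s)) * ennpowr (ennreal (cmod (c y))) s)"
        by (rule mat_apply_bump_le[where b = b])
          (use s \<Gamma> g A[OF True] c in \<open>auto simp: relatively_separated_def\<close>)
      also have "\<dots> \<le> indicator (\<Lambda> \<inter> ?S k) x * v x + nsum (\<lambda>y. ?K x y * u y)"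
      proof (rule add_mono)
        show "ennpowr (ennreal (?\<psi> x * cmod (mat_apply A \<Gamma> c x))) s \<le> indicator (\<Lambda> \<inter> ?S k) x * v x"
        proof (cases "?\<psi> x = 0")
          case False
          then have "x \<in> ?S k"
            using bump_support[OF T0, of k x] by (simp add: dist_norm norm_minus_commute)
          then show ?thesis
            using True s bump_bounds[of T k x]
            by (auto simp: v intro!: ennpowr_mono ennreal_leI mult_left_le_one_le)
        qed simp
        show "nsum (\<lambda>y. indicator \<Gamma> y * (ennpowr (ennreal (norm (H (x - y)))) s
          * ennreal (\<bar>?\<psi> y - ?\<psi> x\<bar> powr s)) * ennpowr (ennreal (cmod (c y))) s)
          \<le> nsum (\<lambda>y. ?K x y * u y)"
          using True by (intro nsum_mono) (auto simp: u split: split_indicator)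
      qed
      finally show ?thesis .
    qed simp
  qed
  also have "\<dots> \<le> 2 * (lnorm ?r (\<lambda>x. indicator (\<Lambda> \<inter> ?S k) x * v x) + lnorm ?r (\<lambda>x. nsum (\<lambda>y. ?K x y * u y)))"
    by (rule lnorm_add_le[OF r])
  also have "\<dots> \<le> 2 * (nsum (\<lambda>x. indicator (\<Lambda> \<inter> ?S k) x * v x) + nsum (\<lambda>j. ?V j * U j))"
  proof (intro mult_left_mono add_mono)
    show "lnorm ?r (\<lambda>x. indicator (\<Lambda> \<inter> ?S k) x * v x) \<le> nsum (\<lambda>x. indicator (\<Lambda> \<inter> ?S k) x * v x)"
      by (rule lnorm_le_nsum[OF r])
    have rel_le: "rel \<Lambda> * a \<le> (rel \<Lambda> + rel \<Gamma>) * a" "rel \<Gamma> * a \<le> (rel \<Lambda> + rel \<Gamma>) * a" for a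
      by (intro mult_right_mono; simp)+
    show "lnorm ?r (\<lambda>x. nsum (\<lambda>y. ?K x y * u y)) \<le> nsum (\<lambda>j. ?V j * U j)"
      unfolding U
    proof (rule lnorm_block_schur[OF r finU])
      fix x :: "real ^ 'd" and j :: "int ^ 'd"
      have "nsum (\<lambda>y. ?K x y * indicator {y. lattice_cell T y = j} y)
          \<le> nsum (\<lambda>y. indicator \<Gamma> y * block_weight s H T k j (fine_cell (x - y)))"
      proof (intro nsum_mono)
        fix y
        show "?K x y * indicator {y. lattice_cell T y = j} y
            \<le> indicator \<Gamma> y * block_weight s H T k j (fine_cell (x - y))"
          using commutator_le_block_weight[OF s(1) T, of H x y k]
          by (auto split: split_indicator)
      qed
      also have "\<dots> \<le> rel \<Gamma> * nsum (block_weight s H T k j)"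
        by (rule nsum_row_bound)
      also have "\<dots> \<le> ?V j" by (rule rel_le)
      finally show "nsum (\<lambda>y. ?K x y * indicator {y. lattice_cell T y = j} y) \<le> ?V j" .
    next
      fix y :: "real ^ 'd"
      let ?j = "lattice_cell T y"
      have "nsum (\<lambda>x. ?K x y) \<le> nsum (\<lambda>x. indicator \<Lambda> x * block_weight s H T k ?j (fine_cell (x - y)))"
        using commutator_le_block_weight[OF s(1) T, of H _ y k]
        by (intro nsum_mono) (auto split: split_indicator)
      also have "\<dots> \<le> rel \<Lambda> * nsum (block_weight s H T k ?j)"
        by (rule nsum_column_bound)
      also have "\<dots> \<le> ?V ?j" by (rule rel_le)
      finally show "nsum (\<lambda>x. ?K x y) \<le> ?V ?j" .
    qed
  qed simp
  finally show ?thesis .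
qed

section \<open>Summing the local estimates\<close>

theorem theorem3p5:
  fixes p0 :: real
    and \<Lambda> \<Gamma> :: "(real ^ 'd) set"
    and A :: "real ^ 'd \<Rightarrow> real ^ 'd \<Rightarrow> complex"
  assumes "0 < p0" and "p0 \<le> 1"
    and "relatively_separated \<Lambda>" and "relatively_separated \<Gamma>"
    and "A \<in> conv_dominated p0 \<Lambda> \<Gamma>"
    and "\<exists>p\<in>{ennreal p0..\<infinity>}. \<exists>C0 :: real. C0 > 0 \<and>
           (\<forall>c\<in>lp p \<Gamma>. lp_norm p \<Lambda> (mat_apply A \<Gamma> c) \<ge> ennreal C0 * lp_norm p \<Gamma> c)"
  shows "\<exists>C :: real. C > 0 \<and>
           (\<forall>q\<in>{ennreal p0..\<infinity>}. \<forall>c\<in>lp q \<Gamma>.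
              lp_norm q \<Lambda> (mat_apply A \<Gamma> c) \<ge> ennreal C * lp_norm q \<Gamma> c)"
proof -
  note s = assms(1,2) and \<Lambda> = assms(3) and \<Gamma> = assms(4)
  obtain H :: "real ^ 'd \<Rightarrow> real" where H: "H \<in> wiener_amalgam p0"
    and "\<And>x y. x \<in> \<Lambda> \<Longrightarrow> y \<in> \<Gamma> \<Longrightarrow> cmod (A x y) \<le> H (x - y)"
    using assms(5) by (auto simp: conv_dominated_def)
  then have A: "\<And>x y. x \<in> \<Lambda> \<Longrightarrow> y \<in> \<Gamma> \<Longrightarrow> cmod (A x y) \<le> norm (H (x - y))"
    by (metis abs_ge_self order_trans real_norm_def)
  obtain p C0 where p: "ennreal p0 \<le> p" and C0: "0 < C0"
    and lower: "\<And>c. c \<in> lp p \<Gamma> \<Longrightarrow> ennreal C0 * lp_norm p \<Gamma> c \<le> lp_norm p \<Lambda> (mat_apply A \<Gamma> c)"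
    using assms(6) by auto
  have g: "nsum (cell_sup p0 H) < top"
    by (rule nsum_cell_sup_finite[OF s(1) H])
  obtain K where K: "0 < K" "\<And>(T::real) (z::real ^ 'd). 0 < T \<Longrightarrow>
      nsum (indicator {k. norm (z - lattice_point T k) \<le> (2 * real CARD('d) + 2) * T}) \<le> ennreal K"
    using lattice_points_near by metis
  define N where "N = enn2real (rel \<Lambda> + rel \<Gamma>)"
  have N: "rel \<Lambda> + rel \<Gamma> = ennreal N" "0 \<le> N"
    using \<Lambda> \<Gamma> by (auto simp: N_def relatively_separated_def)
  define E where "E = C0 powr p0"
  have E: "0 < E" using C0 by (simp add: E_def)
  \<comment> \<open>The averaging term is estimated by \<open>2 * 2 * (2 * K * N * \<eta>) \<le> E / 2\<close> times the norm of \<open>U\<close>.\<close>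
  define \<eta> where "\<eta> = E / (16 * K * (N + 1))"
  have \<eta>: "0 < \<eta>" using E K N by (simp add: \<eta>_def)
  obtain T where T: "1 \<le> T" and small: "nsum (\<lambda>m. damping p0 T m * cell_sup p0 H m) \<le> ennreal \<eta>"
    using damped_sum_small[OF s(1) g \<eta>] .
  have T0: "0 < T" using T by simp
  define R where "R = (real CARD('d) + 1) * T"
  obtain C\<Lambda> where C\<Lambda>: "0 < C\<Lambda>" "\<And>x. nsum (indicator (\<Lambda> \<inter> cball x R)) \<le> ennreal C\<Lambda>"
    using separated_points_near[OF \<Lambda>] by metis
  obtain C\<Gamma> where C\<Gamma>: "0 < C\<Gamma>" "\<And>x. nsum (indicator (\<Gamma> \<inter> cball x R)) \<le> ennreal C\<Gamma>"
    using separated_points_near[OF \<Gamma>] by metis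
  have cell_ball: "{y. lattice_cell T y = j} \<subseteq> cball (lattice_point T j) R" for j :: "int ^ 'd"
    unfolding R_def by (rule cell_subset_cball[OF T0])
  have R_K: "nsum (\<lambda>k. indicator (\<Lambda> \<inter> cball (lattice_point T k) R) x) \<le> ennreal K" for x
  proof -
    have "R \<le> (2 * real CARD('d) + 2) * T"
      using T0 by (simp add: R_def)
    then have "nsum (\<lambda>k. indicator (\<Lambda> \<inter> cball (lattice_point T k) R) x)
      \<le> nsum (indicator {k. norm (x - lattice_point T k) \<le> (2 * real CARD('d) + 2) * T})"
      by (intro nsum_mono) (auto simp: dist_norm norm_minus_commute split: split_indicator)
    also have "\<dots> \<le> ennreal K" by (rule K(2)[OF T0])
    finally show ?thesis .
  qed
  have pos_\<Gamma>: "0 < ennreal (C\<Gamma> + 1)"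
    using C\<Gamma> by (simp del: ennreal_plus)
  have cells_row: "nsum (\<lambda>k. indicator \<Gamma> y * indicator {lattice_cell T y} k) \<le> ennreal (C\<Gamma> + 1)" for y
  proof -
    have "nsum (\<lambda>k. indicator \<Gamma> y * indicator {lattice_cell T y} k) = indicator \<Gamma> y"
      by (rule nsum_single)
    also have "\<dots> \<le> ennreal 1"
      by (auto split: split_indicator)
    also have "\<dots> \<le> ennreal (C\<Gamma> + 1)"
      using C\<Gamma>(1) by (intro ennreal_leI) simp
    finally show ?thesis .
  qed
  have cells_col: "nsum (\<lambda>y. indicator \<Gamma> y * indicator {lattice_cell T y} k) \<le> ennreal (C\<Gamma> + 1)" for k
  proof -
    have "nsum (\<lambda>y. indicator \<Gamma> y * indicator {lattice_cell T y} k)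
        \<le> nsum (indicator (\<Gamma> \<inter> cball (lattice_point T k) R))"
      using subsetD[OF cell_ball[of k]] by (intro nsum_mono) (auto split: split_indicator)
    also have "\<dots> \<le> ennreal C\<Gamma>" by (rule C\<Gamma>)
    also have "\<dots> \<le> ennreal (C\<Gamma> + 1)" by (intro ennreal_leI) simp
    finally show ?thesis .
  qed
  \<comment> \<open>None of the constants in \<open>M\<close>, nor \<open>T\<close>, refers to \<open>q\<close>.\<close>
  define M where "M = 8 * (C\<Lambda> + K) * (C\<Gamma> + 1) / E"
  have M: "0 < M" using C\<Lambda> C\<Gamma> K E by (simp add: M_def)
  have ineq: "lnorm (q / ennreal p0) u \<le> ennreal M * lnorm (q / ennreal p0) v"
    if q: "ennreal p0 \<le> q" and c: "c \<in> lp q \<Gamma>"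
      and u: "u = (\<lambda>y. indicator \<Gamma> y * ennpowr (ennreal (cmod (c y))) p0)"
      and v: "v = (\<lambda>x. indicator \<Lambda> x * ennpowr (ennreal (cmod (mat_apply A \<Gamma> c x))) p0)"
      and fin: "lnorm (q / ennreal p0) u < top"
    for q c u v
  proof -
    let ?r = "q / ennreal p0"
    define U where "U j = lnorm (p / ennreal p0) (\<lambda>y. u y * indicator {y. lattice_cell T y = j} y)" for j
    define Y where "Y k = nsum (\<lambda>x. indicator (\<Lambda> \<inter> cball (lattice_point T k) R) x * v x)" for k
    define W where "W k = nsum (\<lambda>j. ennreal N * nsum (block_weight p0 H T k j) * U j)" for k
    have r: "1 \<le> ?r"
      by (rule one_le_exponent_ratio[OF s(1) q])
    have r': "1 \<le> p / ennreal p0"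
      by (rule one_le_exponent_ratio[OF s(1) p])
    have bd: "ennpowr (ennreal (cmod (c y))) p0 \<le> lnorm ?r u" if "y \<in> \<Gamma>" for y
      using le_lnorm[OF r, of u y] that by (simp add: u)
    have local: "ennreal E * U k \<le> 2 * (Y k + W k)" for k
      using local_lower_bound[OF s p T C0 \<Lambda> \<Gamma> g A lower bd fin, where u = u and v = v and U = U and k = k]
      by (simp add: u v U_def Y_def W_def E_def R_def N)
    have u_le: "lnorm ?r u \<le> ennreal (C\<Gamma> + 1) * lnorm ?r U"
    proof -
      have "lnorm ?r u \<le> lnorm ?r (\<lambda>y. nsum (\<lambda>k. (indicator \<Gamma> y * indicator {lattice_cell T y} k) * U k))"
      proof (rule lnorm_mono[OF r])
        fix y
        have "u y \<le> indicator \<Gamma> y * U (lattice_cell T y)"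
          using le_lnorm[OF r', of "\<lambda>y'. u y' * indicator {y'. lattice_cell T y' = lattice_cell T y} y'" y]
          by (auto simp: U_def u split: split_indicator)
        also have "\<dots> = nsum (\<lambda>k. (indicator \<Gamma> y * indicator {lattice_cell T y} k) * U k)"
          using nsum_single[of "\<lambda>k. indicator \<Gamma> y * U k" "lattice_cell T y"] by (simp add: mult_ac)
        finally show "u y \<le> \<dots>" .
      qed
      also have "\<dots> \<le> ennreal (C\<Gamma> + 1) * lnorm ?r U"
        by (rule lnorm_schur[OF r]) (simp_all only: cells_row cells_col pos_\<Gamma>)
      finally show ?thesis .
    qed
    \<comment> \<open>Finiteness is what permits the subtraction below; it comes from \<open>c \<in> \<ell>\<^sup>q\<close>.\<close>
    have U_fin: "lnorm ?r U < top"
    proof -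
      have "lnorm ?r U \<le> lnorm ?r (\<lambda>k. nsum (\<lambda>y. (indicator \<Gamma> y * indicator {lattice_cell T y} k) * u y))"
      proof (rule lnorm_mono[OF r])
        fix k
        have "U k \<le> nsum (\<lambda>y. u y * indicator {y. lattice_cell T y = k} y)"
          unfolding U_def by (rule lnorm_le_nsum[OF r'])
        also have "\<dots> = nsum (\<lambda>y. (indicator \<Gamma> y * indicator {lattice_cell T y} k) * u y)"
          by (intro nn_integral_cong) (auto simp: u split: split_indicator)
        finally show "U k \<le> \<dots>" .
      qed
      also have "\<dots> \<le> ennreal (C\<Gamma> + 1) * lnorm ?r u"
        by (rule lnorm_schur[OF r]) (simp_all only: cells_row cells_col pos_\<Gamma>)
      also have "\<dots> < top" using fin by (simp add: ennreal_mult_less_top)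
      finally show ?thesis .
    qed
    have Y_le: "lnorm ?r Y \<le> ennreal (C\<Lambda> + K) * lnorm ?r v"
      unfolding Y_def
    proof (rule lnorm_schur[OF r])
      show "nsum (indicator (\<Lambda> \<inter> cball (lattice_point T k) R)) \<le> ennreal (C\<Lambda> + K)" for k :: "int ^ 'd"
        using C\<Lambda>(2) by (rule order_trans) (use K in \<open>intro ennreal_leI, simp\<close>)
      show "nsum (\<lambda>k. indicator (\<Lambda> \<inter> cball (lattice_point T k) R) x) \<le> ennreal (C\<Lambda> + K)" for x
        using R_K by (rule order_trans) (use C\<Lambda> in \<open>intro ennreal_leI, simp\<close>)
    qed (use C\<Lambda> K in \<open>simp del: ennreal_plus\<close>)
    have W_le: "lnorm ?r W \<le> ennreal (E / 8) * lnorm ?r U"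
    proof -
      have "ennreal N * (2 * ennreal K * nsum (\<lambda>m. damping p0 T m * cell_sup p0 H m))
          \<le> ennreal N * (2 * ennreal K * ennreal \<eta>)"
        by (intro mult_left_mono small) auto
      also have "\<dots> = ennreal (N * (2 * K * \<eta>))"
      proof -
        have "(2::ennreal) = ennreal 2" by simp
        then show ?thesis using N K \<eta> by (simp only: ennreal_mult mult_nonneg_nonneg less_imp_le zero_le_numeral)
      qed
      also have "\<dots> \<le> ennreal (E / 8)"
      proof (rule ennreal_leI)
        have "N * (2 * K * \<eta>) = N / (N + 1) * (E / 8)"
        proof -
          have "K \<noteq> 0" "N + 1 \<noteq> 0" using K(1) N(2) by auto
          then show ?thesis unfolding \<eta>_def by (simp add: divide_simps)
        qed
        also have "\<dots> \<le> 1 * (E / 8)"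
          using N E by (intro mult_right_mono) auto
        finally show "N * (2 * K * \<eta>) \<le> E / 8" by simp
      qed
      finally have le: "ennreal N * (2 * ennreal K * nsum (\<lambda>m. damping p0 T m * cell_sup p0 H m)) \<le> ennreal (E / 8)" .
      show ?thesis
        unfolding W_def
      proof (rule lnorm_schur[OF r])
        fix k :: "int ^ 'd"
        have "nsum (\<lambda>j. ennreal N * nsum (block_weight p0 H T k j))
            \<le> ennreal N * (2 * ennreal K * nsum (\<lambda>m. damping p0 T m * cell_sup p0 H m))"
          unfolding nsum_cmult by (intro mult_left_mono block_weight_sums[OF T0 K(2)[OF T0]]) auto
        then show "nsum (\<lambda>j. ennreal N * nsum (block_weight p0 H T k j)) \<le> ennreal (E / 8)"
          using le by (rule order_trans)
      next
        fix j :: "int ^ 'd"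
        have "nsum (\<lambda>k. ennreal N * nsum (block_weight p0 H T k j))
            \<le> ennreal N * (2 * ennreal K * nsum (\<lambda>m. damping p0 T m * cell_sup p0 H m))"
          unfolding nsum_cmult by (intro mult_left_mono block_weight_sums[OF T0 K(2)[OF T0]]) auto
        then show "nsum (\<lambda>k. ennreal N * nsum (block_weight p0 H T k j)) \<le> ennreal (E / 8)"
          using le by (rule order_trans)
      qed (use E in simp)
    qed
    show ?thesis
    proof (cases "lnorm ?r v")
      case top
      then show ?thesis using M by (simp add: ennreal_mult_top)
    next
      case (real t)
      obtain z where z: "lnorm ?r U = ennreal z" "0 \<le> z"
        using U_fin by (cases "lnorm ?r U") auto
      have "ennreal E * lnorm ?r U = lnorm ?r (\<lambda>k. ennreal E * U k)"
        by (rule lnorm_cmult[OF r, symmetric])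
      also have "\<dots> \<le> lnorm ?r (\<lambda>k. 2 * (Y k + W k))"
        by (rule lnorm_mono[OF r local])
      also have "\<dots> = 2 * lnorm ?r (\<lambda>k. Y k + W k)"
        by (rule lnorm_cmult[OF r])
      also have "\<dots> \<le> 2 * (2 * (lnorm ?r Y + lnorm ?r W))"
        by (intro mult_left_mono lnorm_add_le[OF r]) simp
      also have "\<dots> \<le> 2 * (2 * (ennreal (C\<Lambda> + K) * ennreal t + ennreal (E / 8) * ennreal z))"
        using Y_le W_le z real by (intro mult_left_mono add_mono) auto
      also have "\<dots> = ennreal (2 * (2 * ((C\<Lambda> + K) * t + E / 8 * z)))"
      proof -
        have "(2::ennreal) = ennreal 2" by simp
        moreover have "0 \<le> (C\<Lambda> + K)" "0 \<le> E / 8" using C\<Lambda> K E by auto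
        ultimately show ?thesis using real z
          by (simp only: ennreal_mult ennreal_plus mult_nonneg_nonneg add_nonneg_nonneg zero_le_numeral)
      qed
      finally have "ennreal (E * z) \<le> ennreal (2 * (2 * ((C\<Lambda> + K) * t + E / 8 * z)))"
        using z E by (simp add: ennreal_mult)
      moreover have "0 \<le> 2 * (2 * ((C\<Lambda> + K) * t + E / 8 * z))"
        using z E real C\<Lambda> K by simp
      ultimately have "E * z \<le> 2 * (2 * ((C\<Lambda> + K) * t + E / 8 * z))"
        by (simp only: ennreal_le_iff)
      \<comment> \<open>Absorption of \<open>E / 2 * z\<close> into the left-hand side.\<close>
      then have "E * z \<le> 8 * ((C\<Lambda> + K) * t)"
        by (simp add: algebra_simps)
      then have zt: "z \<le> 8 * (C\<Lambda> + K) / E * t"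
        using E by (simp add: field_simps)
      have "lnorm ?r u \<le> ennreal (C\<Gamma> + 1) * ennreal z"
        using u_le z by simp
      also have "\<dots> = ennreal ((C\<Gamma> + 1) * z)"
        using z C\<Gamma> by (intro ennreal_mult[symmetric]) auto
      also have "\<dots> \<le> ennreal ((C\<Gamma> + 1) * (8 * (C\<Lambda> + K) / E * t))"
        using zt C\<Gamma> by (intro ennreal_leI mult_left_mono) auto
      also have "(C\<Gamma> + 1) * (8 * (C\<Lambda> + K) / E * t) = M * t"
        by (simp add: M_def)
      also have "ennreal (M * t) = ennreal M * lnorm ?r v"
        using M real by (simp add: ennreal_mult)
      finally show ?thesis .
    qed
  qed
  show ?thesis
  proof (intro exI[of _ "(1 / M) powr (1 / p0)"] conjI ballI)
    show "0 < (1 / M) powr (1 / p0)" using M by simp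
    fix q c assume "q \<in> {ennreal p0..\<infinity>}" and c: "c \<in> lp q \<Gamma>"
    then have q: "ennreal p0 \<le> q" by simp
    note norm_eq = lp_norm_eq_lnorm[OF s(1) q]
    have "ennpowr (lp_norm q \<Gamma> c) p0 < top"
      using c by (simp add: lp_def)
    then have le: "ennpowr (lp_norm q \<Gamma> c) p0 \<le> ennreal M * ennpowr (lp_norm q \<Lambda> (mat_apply A \<Gamma> c)) p0"
      unfolding norm_eq by (intro ineq[OF q c refl refl])
    have "ennpowr (ennreal ((1 / M) powr (1 / p0)) * lp_norm q \<Gamma> c) p0
        = ennreal (1 / M) * ennpowr (lp_norm q \<Gamma> c) p0"
      using s M by (simp add: ennpowr_mult ennpowr_ennreal powr_powr)
    also have "\<dots> \<le> ennreal (1 / M) * (ennreal M * ennpowr (lp_norm q \<Lambda> (mat_apply A \<Gamma> c)) p0)"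
      by (intro mult_left_mono le) simp
    also have "\<dots> = ennpowr (lp_norm q \<Lambda> (mat_apply A \<Gamma> c)) p0"
      using M by (simp add: mult.assoc[symmetric] ennreal_mult[symmetric])
    finally show "lp_norm q \<Lambda> (mat_apply A \<Gamma> c) \<ge> ennreal ((1 / M) powr (1 / p0)) * lp_norm q \<Gamma> c"
      using s by (simp add: ennpowr_le_iff)
  qed
qed

end
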